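(* Let $A$ be a natural Banach function algebra on a compact Hausdorff space $X$ with $\mathrm{ch}(A)=X$, and let $\varphi\colon A\to\mathbb{C}$ be a (not necessarily linear, not necessarily continuous) multiplicative spectral function. Then the following statements hold. (i) There exists a unique point $x_0\in X$ such that $|\varphi(f)|\le|f(x_0)|$ for all $f\in A$. In particular, $|\varphi(f)|=|f(x_0)|$ for all $f\in G(A)$. (ii) Either $\ker(\varphi)$ is a maximal ideal of $A$, or $1=f_1+\cdots+f_n$ for some $f_1,\dots,f_n\in\ker(\varphi)$. (iii) If $A$ is a uniform algebra, then $\varphi(f)=f(x_0)$ for all $f\in G(A)$, where $x_0$ is the point in (i).
   Context: For a compact Hausdorff space $X$, $C(X)$ is the algebra of continuous complex-valued functions on $X$, with supremum norm $\|\cdot\|_X$. A Banach function algebra on $X$ is a subalgebra $A$ of $C(X)$ that separates the points of $X$, contains the constant functions, and is a Banach algebra under some norm $\|\cdot\|$; it is a uniform algebra if this norm is $\|\cdot\|_X$. It is natural if every character of $A$ is evaluation at some point of $X$; then $\sigma(f)=f(X)$ for all $f\in A$, where $\sigma(f)$ is the spectrum of $f$ in $A$. $G(A)$ denotes the group of invertible elements of $A$. A function $\varphi\colon A\to\mathbb{C}$ is spectral if $\varphi(f)\in\sigma(f)$ for all $f\in A$, and multiplicative if $\varphi(fg)=\varphi(f)\varphi(g)$ for all $f,g\in A$. Here $\ker(\varphi)=\{f\in A:\varphi(f)=0\}$. The Choquet boundary $\mathrm{ch}(A)$ is the set of all $x\in X$ such that the evaluation functional $f\mapsto f(x)$ is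 an extreme point of the closed unit ball of the dual of $(A,\|\cdot\|_X)$. *)

theory Defs
  imports "HOL-Analysis.Analysis" "HOL-Library.Function_Algebras" "HOL-Algebra.Ideal"
begin

text \<open>
  A compact Hausdorff space is a type of class \<^class>\<open>t2_space\<close> whose \<^const>\<open>UNIV\<close> is compact.
  Types are nonempty, but no generality is lost: over the empty space the only function
  algebra is the zero algebra, whose single element has empty spectrum, so that it has no
  spectral function. Functions are added and multiplied pointwise.
\<close>

definition sup_norm :: "('a \<Rightarrow> complex) \<Rightarrow> real" where
  "sup_norm f = (SUP x. cmod (f x))"

definition function_algebra :: "('a::topological_space \<Rightarrow> complex) set \<Rightarrow> bool" where
  "function_algebra A \<longleftrightarrow>
     (\<forall>f\<in>A. continuous_on UNIV f) \<and>
     (\<forall>c. (\<lambda>_. c) \<in> A) \<and>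
     (\<forall>f\<in>A. \<forall>g\<in>A. f + g \<in> A) \<and>
     (\<forall>f\<in>A. \<forall>g\<in>A. f * g \<in> A) \<and>
     (\<forall>c. \<forall>f\<in>A. (\<lambda>x. c * f x) \<in> A) \<and>
     (\<forall>x y. x \<noteq> y \<longrightarrow> (\<exists>f\<in>A. f x \<noteq> f y))"

text \<open>
  The condition \<open>N 1 = 1\<close>, which some authors include for unital Banach algebras, is not imposed.
\<close>

definition banach_algebra_norm ::
    "('a \<Rightarrow> complex) set \<Rightarrow> (('a \<Rightarrow> complex) \<Rightarrow> real) \<Rightarrow> bool" where
  "banach_algebra_norm A N \<longleftrightarrow>
     (\<forall>f\<in>A. 0 \<le> N f) \<and>
     (\<forall>f\<in>A. N f = 0 \<longleftrightarrow> f = 0) \<and>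
     (\<forall>c. \<forall>f\<in>A. N (\<lambda>x. c * f x) = cmod c * N f) \<and>
     (\<forall>f\<in>A. \<forall>g\<in>A. N (f + g) \<le> N f + N g) \<and>
     (\<forall>f\<in>A. \<forall>g\<in>A. N (f * g) \<le> N f * N g) \<and>
     (\<forall>s :: nat \<Rightarrow> 'a \<Rightarrow> complex.
        (\<forall>n. s n \<in> A) \<and> (\<forall>e>0. \<exists>k. \<forall>m\<ge>k. \<forall>n\<ge>k. N (s m - s n) < e) \<longrightarrow>
        (\<exists>f\<in>A. (\<lambda>n. N (s n - f)) \<longlonglongrightarrow> 0))"

definition banach_function_algebra ::
    "('a::topological_space \<Rightarrow> complex) set \<Rightarrow> (('a \<Rightarrow> complex) \<Rightarrow> real) \<Rightarrow> bool" where
  "banach_function_algebra A N \<longleftrightarrow> function_algebra A \<and> banach_algebra_norm A N"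

definition uniform_algebra ::
    "('a::topological_space \<Rightarrow> complex) set \<Rightarrow> (('a \<Rightarrow> complex) \<Rightarrow> real) \<Rightarrow> bool" where
  "uniform_algebra A N \<longleftrightarrow> banach_function_algebra A N \<and> (\<forall>f\<in>A. N f = sup_norm f)"

definition function_ring :: "('a \<Rightarrow> complex) set \<Rightarrow> ('a \<Rightarrow> complex) ring" where
  "function_ring A = \<lparr>carrier = A, mult = (*), one = 1, zero = 0, add = (+)\<rparr>"

abbreviation inv_group :: "('a \<Rightarrow> complex) set \<Rightarrow> ('a \<Rightarrow> complex) set" where
  "inv_group A \<equiv> Units (function_ring A)"

definition spectrum :: "('a \<Rightarrow> complex) set \<Rightarrow> ('a \<Rightarrow> complex) \<Rightarrow> complex set" where
  "spectrum A f = {c. (\<lambda>_. c) - f \<notin> inv_group A}"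

text \<open>
  Functionals on \<open>A\<close> are maps on all functions, of which only the values on \<open>A\<close> matter;
  two functionals are the same when they agree on \<open>A\<close>.
\<close>

definition linear_functional :: "('a \<Rightarrow> complex) set \<Rightarrow> (('a \<Rightarrow> complex) \<Rightarrow> complex) \<Rightarrow> bool" where
  "linear_functional A L \<longleftrightarrow>
     (\<forall>f\<in>A. \<forall>g\<in>A. L (f + g) = L f + L g) \<and>
     (\<forall>c. \<forall>f\<in>A. L (\<lambda>x. c * f x) = c * L f)"

definition multiplicative :: "('a \<Rightarrow> complex) set \<Rightarrow> (('a \<Rightarrow> complex) \<Rightarrow> complex) \<Rightarrow> bool" where
  "multiplicative A \<phi> \<longleftrightarrow> (\<forall>f\<in>A. \<forall>g\<in>A. \<phi> (f * g) = \<phi> f * \<phi> g)"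

definition spectral :: "('a \<Rightarrow> complex) set \<Rightarrow> (('a \<Rightarrow> complex) \<Rightarrow> complex) \<Rightarrow> bool" where
  "spectral A \<phi> \<longleftrightarrow> (\<forall>f\<in>A. \<phi> f \<in> spectrum A f)"

definition algebra_character :: "('a \<Rightarrow> complex) set \<Rightarrow> (('a \<Rightarrow> complex) \<Rightarrow> complex) \<Rightarrow> bool" where
  "algebra_character A \<psi> \<longleftrightarrow>
     linear_functional A \<psi> \<and> multiplicative A \<psi> \<and> (\<exists>f\<in>A. \<psi> f \<noteq> 0)"

definition natural_algebra :: "('a \<Rightarrow> complex) set \<Rightarrow> bool" where
  "natural_algebra A \<longleftrightarrow> (\<forall>\<psi>. algebra_character A \<psi> \<longrightarrow> (\<exists>x. \<forall>f\<in>A. \<psi> f = f x))"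

definition fun_kernel :: "('a \<Rightarrow> complex) set \<Rightarrow> (('a \<Rightarrow> complex) \<Rightarrow> complex) \<Rightarrow> ('a \<Rightarrow> complex) set" where
  "fun_kernel A \<phi> = {f \<in> A. \<phi> f = 0}"

definition dual_unit_ball :: "('a \<Rightarrow> complex) set \<Rightarrow> (('a \<Rightarrow> complex) \<Rightarrow> complex) set" where
  "dual_unit_ball A = {L. linear_functional A L \<and> (\<forall>f\<in>A. cmod (L f) \<le> sup_norm f)}"

text \<open>
  The library's \<^const>\<open>extreme_point_of\<close> needs a type of class \<^class>\<open>real_vector\<close>, which the
  functionals on \<open>A\<close> do not form; the definition below restates it, with equality taken on \<open>A\<close>.
\<close>

definition extreme_functional ::
    "('a \<Rightarrow> complex) set \<Rightarrow> (('a \<Rightarrow> complex) \<Rightarrow> complex) set \<Rightarrow> (('a \<Rightarrow> complex) \<Rightarrow> complex) \<Rightarrow> bool" where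
  "extreme_functional A S E \<longleftrightarrow>
     E \<in> S \<and>
     (\<forall>L\<in>S. \<forall>M\<in>S. \<forall>t::real. 0 < t \<and> t < 1 \<and>
        (\<forall>f\<in>A. E f = of_real (1 - t) * L f + of_real t * M f) \<longrightarrow> (\<forall>f\<in>A. L f = M f))"

definition choquet_boundary :: "('a \<Rightarrow> complex) set \<Rightarrow> 'a set" where
  "choquet_boundary A = {x. extreme_functional A (dual_unit_ball A) (\<lambda>f. f x)}"

end

theory Submission
  imports Defs "HOL-Complex_Analysis.Cauchy_Integral_Formula"
begin

text \<open>
  For small \<open>f\<close> the number \<open>\<phi> (exp f)\<close> has a canonical logarithm, so \<open>\<phi> (exp f) = exp (\<Lambda> f)\<close> with
  \<open>\<Lambda>\<close> additive and \<open>\<Lambda> f \<in> f(X)\<close>. Such a \<open>\<Lambda>\<close> is a character (Kowalski and Slodkowski): it is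
  real-linear, and if \<open>L\<close> and \<open>M\<close> are its complex-linear part and the conjugate of its
  conjugate-linear part, then the entire function \<open>M (exp (z g)) / L (exp (z g))\<close> has modulus less
  than 1 and vanishes at 0, so that \<open>M = 0\<close>; multiplicativity follows from a second application of
  Liouville's theorem. Hence \<open>\<phi> (exp f) = exp (f x\<^sub>0)\<close> for some point \<open>x\<^sub>0\<close>. As \<open>x\<^sub>0\<close> lies in the
  Choquet boundary, there are \<open>g\<close> with \<open>exp (- g)\<close> peaking near \<open>x\<^sub>0\<close>, and the spectral condition
  for \<open>f exp (- g)\<close> gives \<open>\<bar>\<phi> f\<bar> \<le> \<bar>f x\<^sub>0\<bar>\<close>. In a uniform algebra \<open>g\<close> can be replaced by
  a small multiple of \<open>ln (1 + g)\<close>, so that \<open>exp (- g)\<close> has almost real values, and the same argument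
  also recovers the argument of \<open>\<phi> f\<close>.
\<close>

subsection \<open>The Hahn-Banach theorem for sublinear functionals\<close>

text \<open>The hypotheses speak of characters, inverses and extreme functionals; the argument needs
  values of functions. Naturality yields \<open>\<phi> f\<close> in the range of \<open>f\<close>
  only through Gelfand-Mazur: a nonvanishing noninvertible function would lie in a maximal ideal,
  hence in the kernel of a character. Extremality of an evaluation yields peaking functions through
  Hahn-Banach on all bounded real functions: a linear functional below \<open>upper_value x\<close>
  acts like a finitely additive measure representing \<open>x\<close>, and extremality leaves it no
  mass away from \<open>x\<close>. The obstacle is that \<open>\<phi>\<close> is neither additive
  nor continuous. Exponentials turn its multiplicativity into additivity, but only up to multiples
  of 2 pi i; smallness selects the branch, and scaling by 1/n carries the logarithm to all of
  \<open>A\<close>. Peaking controls only Re g. The argument of exp (- g) stays free, so in general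
  only the modulus of \<open>\<phi> f\<close> is caught. The logarithm that removes this freedom is
  a power series whose convergence in \<open>A\<close> follows from sup-norm estimates, which is
  where uniform algebras enter.\<close>

lemma le_cINF_add:
  fixes x y :: "_ \<Rightarrow> real"
  assumes "S \<noteq> {}" "T \<noteq> {}" "\<And>s t. s \<in> S \<Longrightarrow> t \<in> T \<Longrightarrow> a \<le> x s + y t"
  shows "a \<le> (INF s\<in>S. x s) + (INF t\<in>T. y t)"
proof -
  have "a - (INF s\<in>S. x s) \<le> y t" if "t \<in> T" for t
  proof -
    have "a - y t \<le> (INF s\<in>S. x s)"
      using assms that by (intro cINF_greatest) (auto simp: algebra_simps)
    then show ?thesis by simp
  qed
  then have "a - (INF s\<in>S. x s) \<le> (INF t\<in>T. y t)"
    using assms by (intro cINF_greatest) auto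
  then show ?thesis by simp
qed

text \<open>Scalar multiplication is a parameter because Hahn-Banach is applied to two spaces:
  \<open>A\<close> with real scalars, and the bounded real functions.\<close>

locale real_subspace = vector_space scale
  for scale :: "real \<Rightarrow> 'b::ab_group_add \<Rightarrow> 'b" +
  fixes V :: "'b set"
  assumes subspace: "subspace V"
begin

lemma V_add: "f \<in> V \<Longrightarrow> g \<in> V \<Longrightarrow> f + g \<in> V"
  and V_scale: "f \<in> V \<Longrightarrow> scale c f \<in> V"
  and V_zero: "0 \<in> V"
  and V_neg: "f \<in> V \<Longrightarrow> - f \<in> V"
  using subspace subspace_add subspace_scale subspace_0 subspace_neg by blast+

definition sublinear :: "('b \<Rightarrow> real) \<Rightarrow> bool" where
  "sublinear p \<longleftrightarrow>
     (\<forall>f\<in>V. \<forall>g\<in>V. p (f + g) \<le> p f + p g) \<and> (\<forall>c\<ge>0. \<forall>f\<in>V. p (scale c f) = c * p f)"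

lemma sublinear_add: "sublinear p \<Longrightarrow> f \<in> V \<Longrightarrow> g \<in> V \<Longrightarrow> p (f + g) \<le> p f + p g"
  and sublinear_scale: "sublinear p \<Longrightarrow> c \<ge> 0 \<Longrightarrow> f \<in> V \<Longrightarrow> p (scale c f) = c * p f"
  by (auto simp: sublinear_def)

lemma sublinear_zero: "sublinear p \<Longrightarrow> p 0 = 0"
  using sublinear_scale[of p 0 0] V_zero by simp

lemma sublinear_neg_ge:
  assumes "sublinear p" "f \<in> V" shows "- p (- f) \<le> p f"
  using sublinear_add[OF assms V_neg[OF assms(2)]] sublinear_zero[OF assms(1)] by simp

text \<open>The inequality for \<open>1/c\<close> at \<open>scale c f\<close> is the converse of the
  one for \<open>c\<close> at \<open>f\<close>.\<close>

lemma sublinearI: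
  assumes "\<And>f g. f \<in> V \<Longrightarrow> g \<in> V \<Longrightarrow> p (f + g) \<le> p f + p g"
    and le: "\<And>c f. c > 0 \<Longrightarrow> f \<in> V \<Longrightarrow> p (scale c f) \<le> c * p f"
    and zero: "p 0 = 0"
  shows "sublinear p"
proof -
  have "p (scale c f) = c * p f" if c: "c \<ge> 0" and f: "f \<in> V" for c f
  proof (cases "c = 0")
    case False
    then have "c > 0" using c by simp
    have "p f = p (scale (1/c) (scale c f))" using False by simp
    also have "\<dots> \<le> 1/c * p (scale c f)"
      using \<open>c > 0\<close> f by (intro le V_scale) auto
    finally have "c * p f \<le> p (scale c f)"
      using \<open>c > 0\<close> by (simp add: field_simps)
    then show ?thesis using le[OF \<open>c > 0\<close> f] by simp
  qed (simp add: zero)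
  then show ?thesis using assms(1) by (simp add: sublinear_def)
qed

text \<open>
  The largest sublinear minorant of \<open>p\<close> that is linear along the line through \<open>v\<close>.
\<close>

lemma sublinear_linear_along:
  assumes p: "sublinear p" and v: "v \<in> V"
  obtains p' where "sublinear p'" "\<And>f. f \<in> V \<Longrightarrow> p' f \<le> p f" "p' (- v) \<le> - p v"
proof -
  define x where "x f t = p (f + scale t v) - t * p v" for f t
  define p' where "p' f = (INF t\<in>{0..}. x f t)" for f
  have bound: "- p (- f) \<le> x f t" if "f \<in> V" "t \<ge> 0" for f t
    using sublinear_add[OF p V_add[OF that(1) V_scale[OF v]] V_neg[OF that(1)], of t]
      sublinear_scale[OF p that(2) v] unfolding x_def by simp
  have lower: "p' f \<le> x f t" if "f \<in> V" "t \<ge> 0" for f t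
    unfolding p'_def using bound that by (intro cINF_lower) (auto intro!: bdd_belowI2[of _ "- p (- f)"])
  have "sublinear p'"
  proof (rule sublinearI)
    fix f g assume fg: "f \<in> V" "g \<in> V"
    show "p' (f + g) \<le> p' f + p' g"
      unfolding p'_def[of f] p'_def[of g]
    proof (rule le_cINF_add)
      fix s t :: real assume "s \<in> {0..}" "t \<in> {0..}"
      then have st: "s \<ge> 0" "t \<ge> 0" by auto
      have "p' (f + g) \<le> x (f + g) (s + t)" using fg st by (intro lower V_add) auto
      also have "f + g + scale (s + t) v = (f + scale s v) + (g + scale t v)"
        by (simp add: scale_left_distrib)
      then have "x (f + g) (s + t) \<le> x f s + x g t"
        using sublinear_add[OF p V_add[OF fg(1) V_scale[OF v]] V_add[OF fg(2) V_scale[OF v]], of s t]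
        unfolding x_def by (simp add: algebra_simps)
      finally show "p' (f + g) \<le> x f s + x g t" .
    qed auto
  next
    fix c :: real and f assume c: "c > 0" and f: "f \<in> V"
    have "p' (scale c f) / c \<le> x f t" if t: "t \<ge> 0" for t
    proof -
      have "p' (scale c f) \<le> x (scale c f) (c * t)" using c f t by (intro lower V_scale) auto
      also have "scale c f + scale (c * t) v = scale c (f + scale t v)"
        by (simp add: scale_right_distrib)
      then have "x (scale c f) (c * t) = c * x f t"
        using c sublinear_scale[OF p _ V_add[OF f V_scale[OF v]], of c t] unfolding x_def
        by (simp add: algebra_simps)
      finally show ?thesis using c by (simp add: field_simps)
    qed
    then have "p' (scale c f) / c \<le> p' f" unfolding p'_def[of f] by (intro cINF_greatest) auto
    then show "p' (scale c f) \<le> c * p' f" using c by (simp add: field_simps)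
  next
    have "x 0 t = 0" if "t \<ge> 0" for t
      using sublinear_scale[OF p that v] by (simp add: x_def)
    then show "p' 0 = 0" unfolding p'_def by simp
  qed
  moreover have "p' f \<le> p f" if "f \<in> V" for f
    using lower[OF that, of 0] by (simp add: x_def)
  \<comment> \<open>At \<open>t = 1\<close> the argument \<open>- v + v\<close> is zero, so
    \<open>x (- v) 1 = - p v\<close>.\<close>
  moreover have "p' (- v) \<le> - p v"
    using lower[OF V_neg[OF v], of 1] sublinear_zero[OF p] by (simp add: x_def)
  ultimately show ?thesis using that by blast
qed

text \<open>An infimum of sublinear functionals need not be subadditive; along a chain the smaller
  of \<open>p\<close> and \<open>p'\<close> serves at both \<open>f\<close> and \<open>g\<close>.
  The common majorant \<open>q\<close> keeps the infimum finite, through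
  \<open>- q (- f) \<le> p f\<close>.\<close>

lemma sublinear_Inf_chain:
  assumes C: "C \<noteq> {}" "\<And>p. p \<in> C \<Longrightarrow> sublinear p" "\<And>p f. p \<in> C \<Longrightarrow> f \<in> V \<Longrightarrow> p f \<le> q f"
    and chain: "\<And>p p'. p \<in> C \<Longrightarrow> p' \<in> C \<Longrightarrow> (\<forall>f\<in>V. p f \<le> p' f) \<or> (\<forall>f\<in>V. p' f \<le> p f)"
  shows "sublinear (\<lambda>f. INF p\<in>C. p f)"
    and "\<And>p f. p \<in> C \<Longrightarrow> f \<in> V \<Longrightarrow> (INF p\<in>C. p f) \<le> p f"
proof -
  have bound: "- q (- f) \<le> p f" if "p \<in> C" "f \<in> V" for p f
    using sublinear_neg_ge[OF C(2)[OF that(1)] that(2)] C(3)[OF that(1) V_neg[OF that(2)]] by simp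
  show lower: "(INF p\<in>C. p f) \<le> p f" if "p \<in> C" "f \<in> V" for p f
    using bound that by (intro cINF_lower) (auto intro!: bdd_belowI2[of _ "- q (- f)"])
  show "sublinear (\<lambda>f. INF p\<in>C. p f)"
  proof (rule sublinearI)
    fix f g assume fg: "f \<in> V" "g \<in> V"
    show "(INF p\<in>C. p (f + g)) \<le> (INF p\<in>C. p f) + (INF p\<in>C. p g)"
    proof (rule le_cINF_add)
      fix p p' assume p: "p \<in> C" "p' \<in> C"
      obtain r where r: "r \<in> C" "r f \<le> p f" "r g \<le> p' g"
        using chain[OF p] p fg by blast
      have "(INF p\<in>C. p (f + g)) \<le> r (f + g)" using r fg by (intro lower V_add)
      also have "\<dots> \<le> r f + r g" using r fg C by (intro sublinear_add) auto
      finally show "(INF p\<in>C. p (f + g)) \<le> p f + p' g" using r by linarith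
    qed (use C in auto)
  next
    fix c :: real and f assume c: "c > 0" and f: "f \<in> V"
    have "(INF p\<in>C. p (scale c f)) / c \<le> p f" if p: "p \<in> C" for p
      using lower[OF p V_scale[OF f], of c] sublinear_scale[OF C(2)[OF p], of c f] c f
      by (simp add: field_simps)
    then have "(INF p\<in>C. p (scale c f)) / c \<le> (INF p\<in>C. p f)"
      using C by (intro cINF_greatest) auto
    then show "(INF p\<in>C. p (scale c f)) \<le> c * (INF p\<in>C. p f)" using c by (simp add: field_simps)
  next
    have "p 0 = 0" if "p \<in> C" for p using C(2)[OF that] by (rule sublinear_zero)
    then have "(\<lambda>p. p 0) ` C = (\<lambda>_. 0) ` C" by (rule image_cong[OF refl])
    then show "(INF p\<in>C. p 0) = 0" using C(1) by simp
  qed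
qed

text \<open>A minimal sublinear functional is linear, since \<open>sublinear_linear_along\<close>
  cannot lower it in any direction \<open>f\<close>. Zorn's lemma is started below a
  \<open>q'\<close> with \<open>q' (- v) \<le> - q v\<close>, which forces the value at
  \<open>v\<close>.\<close>

lemma Hahn_Banach_dominated:
  assumes q: "sublinear q" and v: "v \<in> V"
  obtains T where "\<And>f g. f \<in> V \<Longrightarrow> g \<in> V \<Longrightarrow> T (f + g) = T f + T g"
    and "\<And>c f. f \<in> V \<Longrightarrow> T (scale c f) = c * T f"
    and "\<And>f. f \<in> V \<Longrightarrow> T f \<le> q f"
    and "T v = q v"
proof -
  obtain q' where q': "sublinear q'" "\<And>f. f \<in> V \<Longrightarrow> q' f \<le> q f" "q' (- v) \<le> - q v"
    using sublinear_linear_along[OF q v] by metis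
  \<comment> \<open>Values outside \<open>V\<close> are fixed at 0, so that the pointwise order on
    \<open>V\<close> is antisymmetric on \<open>S\<close>; \<open>restr\<close> produces this normal
    form.\<close>
  define S where "S = {p. sublinear p \<and> (\<forall>f\<in>V. p f \<le> q' f) \<and> (\<forall>f. f \<notin> V \<longrightarrow> p f = 0)}"
  define P where "P a b \<longleftrightarrow> (\<forall>f\<in>V. b f \<le> a f)" for a b :: "'b \<Rightarrow> real"
  define restr where "restr p f = (if f \<in> V then p f else 0)" for p :: "'b \<Rightarrow> real" and f
  have restr_S: "restr p \<in> S" if "sublinear p" "\<forall>f\<in>V. p f \<le> q' f" for p
    using that V_add V_scale by (auto simp: S_def restr_def sublinear_def)
  have S_eqI: "a = b" if "a \<in> S" "b \<in> S" "P a b" "P b a" for a b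
  proof
    show "a f = b f" for f
      using that by (cases "f \<in> V") (auto simp: S_def P_def intro: antisym)
  qed
  have "\<exists>m\<in>S. \<forall>a\<in>S. P m a \<longrightarrow> a = m"
  proof (rule predicate_Zorn)
    show "partial_order_on S (relation_of P S)"
      proof (rule partial_order_on_relation_ofI)
        show "P a c" if "P a b" "P b c" for a b c
          using that unfolding P_def by (meson order_trans)
      qed (use S_eqI in \<open>auto simp: P_def\<close>)
  next
    fix C assume "C \<in> Chains (relation_of P S)"
    then have CS: "C \<subseteq> S" and chain: "\<And>a b. a \<in> C \<Longrightarrow> b \<in> C \<Longrightarrow> P a b \<or> P b a"
      by (auto simp: Chains_def relation_of_def)
    show "\<exists>u\<in>S. \<forall>a\<in>C. P a u"
    proof (cases "C = {}")
      case True
      then show ?thesis using restr_S[OF q'(1)] by auto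
    next
      case False
      have C2: "\<And>p. p \<in> C \<Longrightarrow> sublinear p" and C3: "\<And>p f. p \<in> C \<Longrightarrow> f \<in> V \<Longrightarrow> p f \<le> q' f"
        using CS by (auto simp: S_def)
      have ch: "(\<forall>f\<in>V. p f \<le> p' f) \<or> (\<forall>f\<in>V. p' f \<le> p f)" if "p \<in> C" "p' \<in> C" for p p'
        using chain[OF that] by (auto simp: P_def)
      have I: "sublinear (\<lambda>f. INF p\<in>C. p f)"
        "\<And>p f. p \<in> C \<Longrightarrow> f \<in> V \<Longrightarrow> (INF p\<in>C. p f) \<le> p f"
        by (rule sublinear_Inf_chain[where C = C and q = q']; use False C2 C3 ch in simp)+
      obtain a where "a \<in> C" using False by blast
      then have "restr (\<lambda>f. INF p\<in>C. p f) \<in> S"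
        using I(2)[of a] C3[of a] by (intro restr_S I) (meson order_trans)
      moreover have "P a (restr (\<lambda>f. INF p\<in>C. p f))" if "a \<in> C" for a
        using I(2) that by (auto simp: P_def restr_def)
      ultimately show ?thesis by blast
    qed
  qed
  then obtain T where T: "T \<in> S" and min: "\<And>a. a \<in> S \<Longrightarrow> P T a \<Longrightarrow> a = T" by blast
  have sub: "sublinear T" and le: "\<And>f. f \<in> V \<Longrightarrow> T f \<le> q' f" using T by (auto simp: S_def)
  have neg: "T (- f) = - T f" if f: "f \<in> V" for f
  proof -
    obtain p where p: "sublinear p" "\<And>f. f \<in> V \<Longrightarrow> p f \<le> T f" "p (- f) \<le> - T f"
      using sublinear_linear_along[OF sub f] by metis
    have "restr p \<in> S" using p(2) le by (intro restr_S p) (meson order_trans)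
    moreover have "P T (restr p)" using p by (auto simp: P_def restr_def)
    ultimately have "restr p = T" by (rule min)
    then have "T (- f) = p (- f)" using V_neg[OF f] by (metis restr_def)
    then show ?thesis using p(3) sublinear_neg_ge[OF sub f] by linarith
  qed
  have add: "T (f + g) = T f + T g" if "f \<in> V" "g \<in> V" for f g
  proof (rule antisym)
    show "T (f + g) \<le> T f + T g" using sublinear_add[OF sub that] .
    show "T f + T g \<le> T (f + g)"
      using sublinear_add[OF sub V_neg[OF that(1)] V_neg[OF that(2)]] neg[OF that(1)]
        neg[OF that(2)] neg[OF V_add[OF that]] by (simp add: add.commute)
  qed
  show ?thesis
  proof
    show "T (scale c f) = c * T f" if "f \<in> V" for c f
    proof (cases "c \<ge> 0")
      case True then show ?thesis using sublinear_scale[OF sub _ that] by simp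
    next
      case False
      then have "T (scale (- c) f) = - c * T f" using sublinear_scale[OF sub _ that, of "- c"] by simp
      then show ?thesis using neg[OF V_scale[OF that], of c] by simp
    qed
    show "T f \<le> q f" if "f \<in> V" for f using le q'(2) that by (meson order_trans)
    show "T v = q v"
      using le[OF V_neg[OF v]] q'(3) neg[OF v] le[OF v] q'(2)[OF v] by linarith
  qed (rule add)
qed

end

subsection \<open>Banach function algebras\<close>

text \<open>As simplification rules these eta-expand functions that are not applied to a point.\<close>

declare plus_fun_apply [simp del] minus_apply [simp del] times_fun_apply [simp del]
  one_fun_apply [simp del]

lemma power_fun_apply: "(f ^ n) x = (f x :: 'b::comm_ring_1) ^ n"
  by (induction n) (auto simp: one_fun_apply times_fun_apply)

lemma sum_fun_apply: "(\<Sum>i\<in>I. f i) x = (\<Sum>i\<in>I. (f i x :: 'b::comm_ring_1))"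
  by (induction I rule: infinite_finite_induct) (auto simp: zero_fun_apply plus_fun_apply)

lemmas fun_apply = plus_fun_apply zero_fun_apply times_fun_apply one_fun_apply minus_apply
  uminus_apply power_fun_apply sum_fun_apply

locale compact_bfa =
  fixes A :: "('a::t2_space \<Rightarrow> complex) set" and N :: "('a \<Rightarrow> complex) \<Rightarrow> real"
  assumes compact_UNIV: "compact (UNIV :: 'a set)"
    and banach_function_algebra: "banach_function_algebra A N"
begin

lemma function_algebra: "function_algebra A" and banach_algebra_norm: "banach_algebra_norm A N"
  using banach_function_algebra by (auto simp: banach_function_algebra_def)

lemma A_cont: "f \<in> A \<Longrightarrow> continuous_on S f"
  using function_algebra continuous_on_subset[of UNIV f S] by (auto simp: function_algebra_def)

lemma A_const: "(\<lambda>_. c) \<in> A"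
  and A_add: "f \<in> A \<Longrightarrow> g \<in> A \<Longrightarrow> f + g \<in> A"
  and A_mult: "f \<in> A \<Longrightarrow> g \<in> A \<Longrightarrow> f * g \<in> A"
  and A_scale: "f \<in> A \<Longrightarrow> (\<lambda>x. c * f x) \<in> A"
  using function_algebra by (auto simp: function_algebra_def)

lemma A_separates: "x \<noteq> y \<Longrightarrow> \<exists>f\<in>A. f x \<noteq> f y"
  using function_algebra by (auto simp: function_algebra_def)

lemma A_0: "0 \<in> A" and A_1: "1 \<in> A"
  using A_const[of 0] A_const[of 1] by (auto simp: zero_fun_def one_fun_def)

lemma A_uminus: "f \<in> A \<Longrightarrow> - f \<in> A"
  using A_scale[of f "-1"] by (simp add: fun_Compl_def)

lemma A_diff: "f \<in> A \<Longrightarrow> g \<in> A \<Longrightarrow> f - g \<in> A"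
  using A_add[OF _ A_uminus, of f g] by simp

lemma A_power: "f \<in> A \<Longrightarrow> f ^ n \<in> A"
  by (induction n) (auto intro: A_1 A_mult)

lemma A_sum: "(\<And>i. i \<in> I \<Longrightarrow> f i \<in> A) \<Longrightarrow> (\<Sum>i\<in>I. f i) \<in> A"
  by (induction I rule: infinite_finite_induct) (auto intro: A_0 A_add)

lemma A_diff_const: "f \<in> A \<Longrightarrow> (\<lambda>x. f x - c) \<in> A"
  using A_diff[OF _ A_const, of f c] by (simp add: fun_diff_def)

lemmas A_closed = A_const A_add A_mult A_scale A_0 A_1 A_uminus A_diff A_power A_sum A_diff_const

lemma N_nonneg: "f \<in> A \<Longrightarrow> 0 \<le> N f"
  and N_eq_0: "f \<in> A \<Longrightarrow> N f = 0 \<longleftrightarrow> f = 0"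
  and N_scale: "f \<in> A \<Longrightarrow> N (\<lambda>x. c * f x) = cmod c * N f"
  and N_add: "f \<in> A \<Longrightarrow> g \<in> A \<Longrightarrow> N (f + g) \<le> N f + N g"
  and N_mult: "f \<in> A \<Longrightarrow> g \<in> A \<Longrightarrow> N (f * g) \<le> N f * N g"
  using banach_algebra_norm by (auto simp: banach_algebra_norm_def)

lemma N_complete:
  assumes "\<And>n. s n \<in> A" "\<And>e. e > 0 \<Longrightarrow> \<exists>k. \<forall>m\<ge>k. \<forall>n\<ge>k. N (s m - s n) < e"
  obtains f where "f \<in> A" "(\<lambda>n. N (s n - f)) \<longlonglongrightarrow> 0"
  using banach_algebra_norm assms unfolding banach_algebra_norm_def by metis

lemma N_uminus: "f \<in> A \<Longrightarrow> N (- f) = N f"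
  using N_scale[of f "-1"] by (simp add: fun_Compl_def)

lemma N_diff_commute: "f \<in> A \<Longrightarrow> g \<in> A \<Longrightarrow> N (f - g) = N (g - f)"
  using N_uminus[OF A_diff, of f g] by simp

lemma N_0: "N 0 = 0"
  using N_eq_0[OF A_0] by simp

text \<open>The factor \<open>N 1\<close> is there for \<open>f ^ 0\<close>: the norm of the unit
  need not be 1.\<close>

lemma N_power: "f \<in> A \<Longrightarrow> N (f ^ n) \<le> N 1 * N f ^ n"
proof (induction n)
  case (Suc n)
  have "N (f ^ Suc n) \<le> N f * N (f ^ n)" using Suc by (simp add: N_mult A_power)
  also have "\<dots> \<le> N f * (N 1 * N f ^ n)" using Suc by (intro mult_left_mono N_nonneg) auto
  finally show ?case by (simp add: algebra_simps)
qed simp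

lemma N_sum: "finite I \<Longrightarrow> (\<And>i. i \<in> I \<Longrightarrow> f i \<in> A) \<Longrightarrow> N (\<Sum>i\<in>I. f i) \<le> (\<Sum>i\<in>I. N (f i))"
proof (induction I rule: finite_induct)
  case (insert i I)
  have "N (f i + sum f I) \<le> N (f i) + N (sum f I)" using insert by (intro N_add A_sum) auto
  also have "\<dots> \<le> N (f i) + (\<Sum>i\<in>I. N (f i))" using insert by (intro add_left_mono) auto
  finally show ?case using insert by simp
qed (simp add: N_0)

lemma N_series_converges:
  assumes s: "\<And>n. s n \<in> A" and sm: "summable (\<lambda>n. N (s n))"
  obtains f where "f \<in> A" "(\<lambda>n. N ((\<Sum>k<n. s k) - f)) \<longlonglongrightarrow> 0"
proof (rule N_complete[of "\<lambda>n. \<Sum>k<n. s k"])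
  show "(\<Sum>k<n. s k) \<in> A" for n using s by (intro A_sum)
  fix e :: real assume "e > 0"
  then obtain k where k: "\<And>m n. m \<ge> k \<Longrightarrow> norm (\<Sum>i=m..<n. N (s i)) < e"
    using sm unfolding summable_Cauchy by metis
  have le: "N ((\<Sum>i<n. s i) - (\<Sum>i<m. s i)) < e" if "m \<ge> k" "m \<le> n" for m n
  proof -
    have "(\<Sum>i<n. s i) = (\<Sum>i<m. s i) + (\<Sum>i=m..<n. s i)"
      using that by (metis atLeast0LessThan sum.atLeastLessThan_concat zero_le)
    then have "N ((\<Sum>i<n. s i) - (\<Sum>i<m. s i)) = N (\<Sum>i=m..<n. s i)" by simp
    also have "\<dots> \<le> (\<Sum>i=m..<n. N (s i))" using s by (intro N_sum) auto
    also have "\<dots> < e" using k[OF that(1), of n] by simp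
    finally show ?thesis .
  qed
  have "N ((\<Sum>i<m. s i) - (\<Sum>i<n. s i)) < e" if "m \<ge> k" "n \<ge> k" for m n
    using le[of m n] le[of n m] that N_diff_commute[OF A_sum[of "{..<m}" s, OF s] A_sum[of "{..<n}" s, OF s]]
    by (cases "m \<le> n") auto
  then show "\<exists>k. \<forall>m\<ge>k. \<forall>n\<ge>k. N ((\<Sum>i<m. s i) - (\<Sum>i<n. s i)) < e" by blast
qed (use that in auto)

lemma Neumann:
  assumes f: "f \<in> A" and less: "N f < 1"
  obtains g where "g \<in> A" "g * (1 - f) = 1"
proof -
  have geo: "(\<lambda>n. N 1 * N f ^ n) \<longlonglongrightarrow> N 1 * 0"
    using less N_nonneg[OF f] by (intro tendsto_intros LIMSEQ_realpow_zero) auto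
  have "summable (\<lambda>n. N 1 * N f ^ n)"
    using less N_nonneg[OF f] by (intro summable_mult summable_geometric) auto
  then have "summable (\<lambda>n. N (f ^ n))"
    by (rule summable_comparison_test'[where N = 0]) (use N_power N_nonneg A_power f in auto)
  then obtain g where g: "g \<in> A" "(\<lambda>n. N ((\<Sum>k<n. f ^ k) - g)) \<longlonglongrightarrow> 0"
    using N_series_converges[of "\<lambda>n. f ^ n"] A_power f by metis
  \<comment> \<open>The left side does not depend on \<open>n\<close>, and both terms on the right
    tend to 0.\<close>
  have "N (g * (1 - f) - 1) \<le> N ((\<Sum>k<n. f ^ k) - g) * N (1 - f) + N 1 * N f ^ n" for n
  proof -
    have S: "(\<Sum>k<n. f ^ k) \<in> A" using f by (intro A_closed)
    have geom: "(\<Sum>k<n. f ^ k) * (1 - f) = 1 - f ^ n"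
      using one_diff_power_eq[of f n] by (simp add: mult.commute)
    have "N (g * (1 - f) - 1) = N (1 - g * (1 - f))"
      using f g by (intro N_diff_commute A_closed)
    also have "1 - g * (1 - f) = ((\<Sum>k<n. f ^ k) - g) * (1 - f) + f ^ n"
      unfolding left_diff_distrib geom by simp
    also have "N \<dots> \<le> N (((\<Sum>k<n. f ^ k) - g) * (1 - f)) + N (f ^ n)"
      using S f g by (intro N_add A_closed)
    also have "\<dots> \<le> N ((\<Sum>k<n. f ^ k) - g) * N (1 - f) + N 1 * N f ^ n"
      using S f g by (intro add_mono N_mult N_power A_closed)
    finally show ?thesis .
  qed
  moreover have "(\<lambda>n. N ((\<Sum>k<n. f ^ k) - g) * N (1 - f) + N 1 * N f ^ n) \<longlonglongrightarrow> 0 * N (1 - f) + N 1 * 0"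
    by (intro tendsto_add geo tendsto_mult g(2) tendsto_const)
  ultimately have "N (g * (1 - f) - 1) \<le> 0 * N (1 - f) + N 1 * 0"
    by (intro LIMSEQ_le_const) auto
  moreover have in_A: "g * (1 - f) - 1 \<in> A" using f g by (intro A_closed)
  ultimately have "N (g * (1 - f) - 1) = 0" using N_nonneg[OF in_A] by simp
  then have "g * (1 - f) = 1" using N_eq_0[OF in_A] by simp
  with g show ?thesis using that by blast
qed

text \<open>If \<open>N f\<close> were smaller, \<open>f / f x\<close> would have norm below 1 and
  \<open>1 - f / f x\<close> would be invertible by the Neumann series, although it vanishes at
  \<open>x\<close>.\<close>

lemma cmod_le_N:
  assumes f: "f \<in> A" shows "cmod (f x) \<le> N f"
proof (rule ccontr)
  assume less: "\<not> cmod (f x) \<le> N f"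
  then have nz: "f x \<noteq> 0" using N_nonneg[OF f] by auto
  define h where "h = (\<lambda>y. 1 / f x * f y)"
  have "h \<in> A" unfolding h_def using f by (rule A_scale)
  moreover have "N h < 1"
    unfolding h_def N_scale[OF f] using less nz by (simp add: norm_divide)
  ultimately obtain g where "g * (1 - h) = 1" by (rule Neumann)
  then have "(g * (1 - h)) x = (1 :: 'a \<Rightarrow> complex) x" by simp
  then have "g x * (1 - h x) = 1" by (simp only: fun_apply)
  then show False using nz by (simp add: h_def)
qed

lemma bounded_range_A: "f \<in> A \<Longrightarrow> bdd_above (range (\<lambda>x. cmod (f x)))"
  using cmod_le_N by (intro bdd_aboveI2)

lemma cmod_le_sup_norm: "f \<in> A \<Longrightarrow> cmod (f x) \<le> sup_norm f"
  unfolding sup_norm_def by (intro cSUP_upper bounded_range_A) auto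

lemma sup_norm_le: "(\<And>x. cmod (f x) \<le> c) \<Longrightarrow> sup_norm f \<le> c" for f :: "'a \<Rightarrow> complex"
  unfolding sup_norm_def by (intro cSUP_least) auto

lemma sup_norm_nonneg: "f \<in> A \<Longrightarrow> 0 \<le> sup_norm f"
  by (rule order_trans[OF norm_ge_zero cmod_le_sup_norm])

text \<open>The series converges in \<open>N\<close> by completeness; as \<open>N\<close> dominates
  every point value, its limit is the pointwise sum \<open>F\<close>.\<close>

lemma power_series_in_A:
  assumes f: "f \<in> A" and sm: "summable (\<lambda>n. cmod (a n) * N f ^ n)"
    and sums: "\<And>x. (\<lambda>n. a n * f x ^ n) sums F x"
  shows "F \<in> A"
proof -
  define s where "s n = (\<lambda>x. a n * (f ^ n) x)" for n
  have s: "s n \<in> A" for n unfolding s_def using f by (intro A_scale A_power)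
  have "summable (\<lambda>n. N 1 * (cmod (a n) * N f ^ n))" using sm by (rule summable_mult)
  moreover have "N (s n) \<le> N 1 * (cmod (a n) * N f ^ n)" for n
  proof -
    have "N (s n) = cmod (a n) * N (f ^ n)"
      unfolding s_def using f by (intro N_scale A_power)
    also have "\<dots> \<le> cmod (a n) * (N 1 * N f ^ n)" using f by (intro mult_left_mono N_power) auto
    finally show ?thesis by (simp add: mult_ac)
  qed
  moreover have "norm (N (s n)) = N (s n)" for n using N_nonneg[OF s] by simp
  ultimately have "summable (\<lambda>n. N (s n))"
    by (metis (no_types, lifting) summable_comparison_test')
  with s obtain g where g: "g \<in> A" "(\<lambda>n. N ((\<Sum>k<n. s k) - g)) \<longlonglongrightarrow> 0"
    by (rule N_series_converges)
  have "F x = g x" for x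
  proof -
    have "cmod ((\<Sum>k<n. a k * f x ^ k) - g x) \<le> N ((\<Sum>k<n. s k) - g)" for n
    proof -
      have "(\<Sum>k<n. s k) - g \<in> A" using s g by (intro A_diff A_sum)
      moreover have "((\<Sum>k<n. s k) - g) x = (\<Sum>k<n. a k * f x ^ k) - g x"
        by (simp only: minus_apply sum_fun_apply s_def power_fun_apply)
      ultimately show ?thesis using cmod_le_N by metis
    qed
    then have "(\<lambda>n. (\<Sum>k<n. a k * f x ^ k) - g x) \<longlonglongrightarrow> 0"
      by (intro Lim_null_comparison[OF _ g(2)] always_eventually allI)
    then have "(\<lambda>n. a n * f x ^ n) sums g x"
      unfolding sums_def by (simp add: LIM_zero_iff)
    then show ?thesis using sums[of x] sums_unique2 by blast
  qed
  then have "F = g" by (rule ext)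
  then show ?thesis using g by simp
qed

lemma exp_in_A:
  assumes f: "f \<in> A" shows "(\<lambda>x. exp (f x)) \<in> A"
proof (rule power_series_in_A[OF f, of "\<lambda>n. 1 / fact n"])
  show "(\<lambda>n. 1 / fact n * f x ^ n) sums exp (f x)" for x
    using exp_converges[of "f x"] by (simp add: scaleR_conv_of_real field_simps)
  show "summable (\<lambda>n. cmod (1 / fact n) * N f ^ n)"
    using summable_exp[of "N f"] by (simp add: norm_divide field_simps)
qed

text \<open>For \<open>Re z \<ge> 1\<close> and \<open>c\<close> large, \<open>1 - z / c\<close> lies in the open unit disc.\<close>

lemma Ln_in_A:
  assumes uniform: "uniform_algebra A N" and f: "f \<in> A" and ge: "\<And>x. Re (f x) \<ge> 1"
  shows "(\<lambda>x. Ln (f x)) \<in> A"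
proof -
  define R where "R = sup_norm f"
  have R: "cmod (f x) \<le> R" for x using cmod_le_sup_norm[OF f] by (simp add: R_def)
  have "R \<ge> 1" using R[of undefined] ge[of undefined] complex_Re_le_cmod[of "f undefined"] by linarith
  \<comment> \<open>For \<open>z = f x\<close>, expanding gives |z/c - 1|^2 <= R^2/c^2 - 2/c + 1,
    and \<open>c = R\<^sup>2\<close> turns the right side into 1 - 1/c, uniformly in
    \<open>x\<close>.\<close>
  define c where "c = R\<^sup>2"
  have c: "c \<ge> 1" using \<open>R \<ge> 1\<close> by (simp add: c_def)
  define w where "w = (\<lambda>x. (1 / of_real c) * f x - 1)"
  have w: "w \<in> A" unfolding w_def using f by (intro A_diff_const A_scale)
  have cmod_w: "cmod (w x) \<le> sqrt (1 - 1 / c)" for x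
  proof -
    have "Re (w x) = Re (f x) / c - 1" "Im (w x) = Im (f x) / c" by (simp_all add: w_def)
    then have "(cmod (w x))\<^sup>2 = (Re (f x) / c - 1)\<^sup>2 + (Im (f x) / c)\<^sup>2"
      by (simp only: cmod_power2)
    also have "\<dots> = (cmod (f x))\<^sup>2 / c\<^sup>2 - 2 * Re (f x) / c + 1"
      using c unfolding cmod_power2 by (simp add: field_simps power2_eq_square)
    also have "\<dots> \<le> c / c\<^sup>2 - 2 / c + 1"
      using c ge[of x] power_mono[OF R[of x], of 2]
      by (intro add_right_mono diff_mono divide_right_mono) (auto simp: c_def)
    also have "\<dots> = 1 - 1 / c" using c by (simp add: field_simps power2_eq_square)
    finally show ?thesis by (rule real_le_rsqrt)
  qed
  have less: "sqrt (1 - 1 / c) < 1" using c by simp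
  \<comment> \<open>Here the uniform norm matters: the pointwise bound on \<open>w\<close> becomes a
    bound on \<open>N w\<close>.\<close>
  have "N w = sup_norm w" using uniform w by (auto simp: uniform_algebra_def)
  then have "N w < 1" using sup_norm_le[of w, OF cmod_w] less by linarith
  have "(\<lambda>x. Ln (1 + w x)) \<in> A"
  \<comment> \<open>The coefficient for \<open>n = 0\<close> is 0, because division by zero yields
    0.\<close>
  proof (rule power_series_in_A[OF w, of "\<lambda>n. (-1) ^ Suc n / of_nat n"])
    show "(\<lambda>n. (-1) ^ Suc n / of_nat n * w x ^ n) sums Ln (1 + w x)" for x
      using cmod_w[of x] less by (intro Ln_series) linarith
    have "summable (\<lambda>n. N w ^ n)"
      using \<open>N w < 1\<close> N_nonneg[OF w] by (intro summable_geometric) simp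
    then show "summable (\<lambda>n. cmod ((-1) ^ Suc n / of_nat n) * N w ^ n)"
    proof (rule summable_comparison_test'[where N = 0])
      fix n
      have "cmod ((-1) ^ Suc n / of_nat n) \<le> 1"
        by (cases n) (auto simp: norm_divide norm_power simp del: of_nat_Suc)
      then show "norm (cmod ((-1) ^ Suc n / of_nat n) * N w ^ n) \<le> N w ^ n"
        using N_nonneg[OF w] by (simp add: abs_mult mult_left_le_one_le)
    qed
  qed
  moreover have "Ln (f x) = Ln (of_real c) + Ln (1 + w x)" for x
  proof -
    have "f x = of_real c * (1 + w x)" using c by (simp add: w_def)
    moreover have "1 + w x \<noteq> 0" using ge[of x] c by (auto simp: w_def)
    ultimately show ?thesis using c Ln_times_of_real[of c "1 + w x"] by (simp add: Ln_of_real)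
  qed
  ultimately show ?thesis
    using A_add[OF A_const[of "Ln (of_real c)"], of "\<lambda>x. Ln (1 + w x)"] by (simp add: plus_fun_def)
qed

end

subsection \<open>The Gelfand-Mazur theorem and spectra in natural algebras\<close>

text \<open>Used twice: for resolvents, where the remainder comes from the resolvent identity, and
  for exponentials, where it comes from Taylor's formula.\<close>

lemma has_field_derivative_quadratic_bound:
  fixes F :: "complex \<Rightarrow> complex"
  assumes "e > 0"
    and bound: "\<And>w. cmod (w - z) < e \<Longrightarrow> cmod (F w - F z - (w - z) * D) \<le> K * (cmod (w - z))\<^sup>2"
  shows "(F has_field_derivative D) (at z)"
proof -
  have "((\<lambda>w. (F w - F z) / (w - z) - D) \<longlongrightarrow> 0) (at z)"
  proof (rule Lim_null_comparison)
    have "cmod ((F w - F z) / (w - z) - D) \<le> K * cmod (w - z)" if "w \<noteq> z" "dist w z < e" for w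
    proof -
      have "(F w - F z) / (w - z) - D = (F w - F z - (w - z) * D) / (w - z)"
        using that by (simp add: field_simps)
      then show ?thesis
        using bound[of w] that
        by (simp add: norm_divide dist_norm divide_le_eq power2_eq_square mult.assoc)
    qed
    then show "\<forall>\<^sub>F w in at z. cmod ((F w - F z) / (w - z) - D) \<le> K * cmod (w - z)"
      unfolding eventually_at using \<open>e > 0\<close> by blast
    have "((\<lambda>w. K * cmod (w - z)) \<longlongrightarrow> K * cmod (z - z)) (at z)"
      by (intro tendsto_intros)
    then show "((\<lambda>w. K * cmod (w - z)) \<longlongrightarrow> 0) (at z)" by simp
  qed
  then show ?thesis unfolding has_field_derivative_iff by (simp add: LIM_zero_iff)
qed

lemma le_mult_cINF:
  fixes x :: "_ \<Rightarrow> real"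
  assumes "S \<noteq> {}" "c \<ge> 0" "\<And>s. s \<in> S \<Longrightarrow> a \<le> c * x s"
  shows "a \<le> c * (INF s\<in>S. x s)"
proof (cases "c = 0")
  case False
  then have "c > 0" using assms by simp
  then have "a / c \<le> (INF s\<in>S. x s)"
    using assms by (intro cINF_greatest) (auto simp: divide_le_eq mult.commute)
  then show ?thesis using \<open>c > 0\<close> by (simp add: divide_le_eq mult.commute)
qed (use assms in auto)

text \<open>For real-linear \<open>T\<close> this is twice the complex-linear part; for real-valued
  \<open>T\<close> it is the complex-linear functional with real part \<open>T\<close>.\<close>

definition complexify :: "(('a \<Rightarrow> complex) \<Rightarrow> complex) \<Rightarrow> ('a \<Rightarrow> complex) \<Rightarrow> complex" where
  "complexify T f = T f - \<i> * T (\<lambda>x. \<i> * f x)"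

context compact_bfa
begin

lemma complexify_linear:
  assumes add: "\<And>f g. f \<in> A \<Longrightarrow> g \<in> A \<Longrightarrow> T (f + g) = T f + T g"
    and scale: "\<And>r f. f \<in> A \<Longrightarrow> T (\<lambda>x. complex_of_real r * f x) = of_real r * T f"
  shows "linear_functional A (complexify T)"
  unfolding linear_functional_def
proof (intro conjI ballI allI)
  fix f g assume fg: "f \<in> A" "g \<in> A"
  have "(\<lambda>x. \<i> * (f + g) x) = (\<lambda>x. \<i> * f x) + (\<lambda>x. \<i> * g x)"
    by (auto simp: fun_apply algebra_simps)
  then show "complexify T (f + g) = complexify T f + complexify T g"
    using fg by (simp add: complexify_def add A_scale algebra_simps)
next
  fix c f assume f: "f \<in> A"
  have T: "T (\<lambda>x. c * f x) = of_real (Re c) * T f + of_real (Im c) * T (\<lambda>x. \<i> * f x)" for c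
  proof -
    have "(\<lambda>x. c * f x) = (\<lambda>x. of_real (Re c) * f x) + (\<lambda>x. of_real (Im c) * (\<i> * f x))"
      by (rule ext) (simp add: fun_apply complex_eq_iff)
    then have "T (\<lambda>x. c * f x) =
        T (\<lambda>x. of_real (Re c) * f x) + T (\<lambda>x. of_real (Im c) * (\<i> * f x))"
      using f add[OF A_scale A_scale[OF A_scale], of f f] by simp
    then show ?thesis using f scale[OF f] scale[OF A_scale[OF f]] by simp
  qed
  have "(\<lambda>x. \<i> * (c * f x)) = (\<lambda>x. (\<i> * c) * f x)" by (simp add: mult.assoc)
  then have "complexify T (\<lambda>x. c * f x) = T (\<lambda>x. c * f x) - \<i> * T (\<lambda>x. (\<i> * c) * f x)"
    by (simp only: complexify_def)
  also have "\<dots> = c * complexify T f"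
    unfolding T[of c] T[of "\<i> * c"] complexify_def by (simp add: complex_eq_iff algebra_simps)
  finally show "complexify T (\<lambda>x. c * f x) = c * complexify T f" .
qed

text \<open>Closure under negation comes from absorbing the constant -1, and absorption on one side
  suffices in a commutative algebra.\<close>

definition fun_ideal :: "('a \<Rightarrow> complex) set \<Rightarrow> bool" where
  "fun_ideal J \<longleftrightarrow> J \<subseteq> A \<and> 0 \<in> J \<and> (\<forall>f\<in>J. \<forall>g\<in>J. f + g \<in> J) \<and> (\<forall>f\<in>J. \<forall>g\<in>A. g * f \<in> J)"

lemma maximal_ideal_exists:
  assumes "fun_ideal I" "1 \<notin> I"
  obtains J where "fun_ideal J" "1 \<notin> J" "I \<subseteq> J"
    "\<And>K. fun_ideal K \<Longrightarrow> 1 \<notin> K \<Longrightarrow> J \<subseteq> K \<Longrightarrow> K = J"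
proof -
  define S where "S = {J. fun_ideal J \<and> 1 \<notin> J \<and> I \<subseteq> J}"
  have "\<exists>M\<in>S. \<forall>X\<in>S. M \<subseteq> X \<longrightarrow> X = M"
  proof (rule subset_Zorn_nonempty)
    show "S \<noteq> {}" using assms by (auto simp: S_def)
    fix C assume C: "C \<noteq> {}" "subset.chain S C"
    then have CS: "\<And>J. J \<in> C \<Longrightarrow> fun_ideal J \<and> 1 \<notin> J \<and> I \<subseteq> J"
      and chain: "\<And>J K. J \<in> C \<Longrightarrow> K \<in> C \<Longrightarrow> J \<subseteq> K \<or> K \<subseteq> J"
      by (auto simp: S_def subset_chain_def)
    have "f + g \<in> \<Union>C" if fg: "f \<in> \<Union>C" "g \<in> \<Union>C" for f g
    proof -
      obtain J K where J: "J \<in> C" "f \<in> J" and K: "K \<in> C" "g \<in> K" using fg by blast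
      then obtain M where M: "M \<in> C" "f \<in> M" "g \<in> M" using chain[OF J(1) K(1)] by blast
      then have "f + g \<in> M" using CS[OF M(1)] by (auto simp: fun_ideal_def)
      then show ?thesis using M by blast
    qed
    moreover have "\<Union>C \<subseteq> A" "1 \<notin> \<Union>C" "\<And>f g. f \<in> \<Union>C \<Longrightarrow> g \<in> A \<Longrightarrow> g * f \<in> \<Union>C"
      using CS unfolding fun_ideal_def by blast+
    moreover have "0 \<in> \<Union>C" "I \<subseteq> \<Union>C" using CS C(1) unfolding fun_ideal_def by blast+
    ultimately show "\<Union>C \<in> S" unfolding S_def fun_ideal_def by blast
  qed
  then obtain J where J: "J \<in> S" "\<And>X. X \<in> S \<Longrightarrow> J \<subseteq> X \<Longrightarrow> X = J" by blast
  have "K = J" if "fun_ideal K" "1 \<notin> K" "J \<subseteq> K" for K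
    using J that unfolding S_def by blast
  with J(1) show ?thesis using that unfolding S_def by blast
qed

end

section \<open>The quotient of the algebra by a proper ideal\<close>

locale proper_fun_ideal = compact_bfa +
  fixes J assumes ideal: "fun_ideal J" and proper: "1 \<notin> J"
begin

lemma J_A: "f \<in> J \<Longrightarrow> f \<in> A"
  and J_0: "0 \<in> J"
  and J_add: "f \<in> J \<Longrightarrow> g \<in> J \<Longrightarrow> f + g \<in> J"
  and J_mult: "f \<in> J \<Longrightarrow> g \<in> A \<Longrightarrow> g * f \<in> J"
  using ideal by (auto simp: fun_ideal_def)

lemma J_scale: "f \<in> J \<Longrightarrow> (\<lambda>x. c * f x) \<in> J"
  using J_mult[OF _ A_const, of f c] by (simp add: times_fun_def)

lemma J_uminus: "f \<in> J \<Longrightarrow> - f \<in> J"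
  using J_scale[of f "-1"] by (simp add: fun_Compl_def)

lemma J_diff: "f \<in> J \<Longrightarrow> g \<in> J \<Longrightarrow> f - g \<in> J"
  using J_add[OF _ J_uminus, of f g] by simp

lemma A_diff_J: "f \<in> A \<Longrightarrow> j \<in> J \<Longrightarrow> f - j \<in> A"
  using A_diff J_A by blast

text \<open>The quotient seminorm lifted to \<open>A\<close>. Equality in the quotient is expressed
  as \<open>f - g \<in> J\<close>, so no quotient space is formed.\<close>

definition quot_norm :: "('a \<Rightarrow> complex) \<Rightarrow> real" where
  "quot_norm f = (INF j\<in>J. N (f - j))"

lemma quot_norm_le: "f \<in> A \<Longrightarrow> j \<in> J \<Longrightarrow> quot_norm f \<le> N (f - j)"
  unfolding quot_norm_def
  by (intro cINF_lower) (auto intro!: bdd_belowI2[of _ 0] N_nonneg A_diff_J)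

lemma quot_norm_greatest: "(\<And>j. j \<in> J \<Longrightarrow> a \<le> N (f - j)) \<Longrightarrow> a \<le> quot_norm f"
  unfolding quot_norm_def using J_0 by (intro cINF_greatest) auto

lemma quot_norm_nonneg: "f \<in> A \<Longrightarrow> 0 \<le> quot_norm f"
  by (intro quot_norm_greatest N_nonneg A_diff_J)

lemma quot_norm_cong:
  assumes "f \<in> A" "g \<in> A" "f - g \<in> J" shows "quot_norm f = quot_norm g"
proof -
  have le: "quot_norm f \<le> quot_norm g" if "f \<in> A" "f - g \<in> J" for f g
  proof (rule quot_norm_greatest)
    fix j assume "j \<in> J"
    then show "quot_norm f \<le> N (g - j)"
      using quot_norm_le[OF that(1) J_add[OF that(2)], of j] by (simp add: algebra_simps)
  qed
  have "g - f \<in> J" using J_uminus[OF assms(3)] by simp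
  then show ?thesis using le assms by (intro antisym) auto
qed

lemma quot_norm_0: "quot_norm 0 = 0"
  using quot_norm_le[OF A_0 J_0] quot_norm_nonneg[OF A_0] N_0 by simp

lemma quot_norm_J: "f \<in> J \<Longrightarrow> quot_norm f = 0"
  using quot_norm_cong[of f 0] quot_norm_0 J_A A_0 by simp

lemma quot_norm_add:
  assumes "f \<in> A" "g \<in> A" shows "quot_norm (f + g) \<le> quot_norm f + quot_norm g"
  unfolding quot_norm_def[of f] quot_norm_def[of g]
proof (rule le_cINF_add)
  fix i j assume ij: "i \<in> J" "j \<in> J"
  have "quot_norm (f + g) \<le> N (f + g - (i + j))" using assms ij by (intro quot_norm_le A_add J_add)
  also have "f + g - (i + j) = (f - i) + (g - j)" by (simp add: algebra_simps)
  also have "N \<dots> \<le> N (f - i) + N (g - j)" using assms ij by (intro N_add A_diff_J)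
  finally show "quot_norm (f + g) \<le> N (f - i) + N (g - j)" .
qed (use J_0 in auto)

lemma quot_norm_scale:
  assumes f: "f \<in> A" shows "quot_norm (\<lambda>x. c * f x) = cmod c * quot_norm f"
proof -
  have le: "quot_norm (\<lambda>x. c * f x) \<le> cmod c * quot_norm f" if f: "f \<in> A" for c f
    unfolding quot_norm_def[of f]
  proof (rule le_mult_cINF)
    fix j assume j: "j \<in> J"
    have "quot_norm (\<lambda>x. c * f x) \<le> N ((\<lambda>x. c * f x) - (\<lambda>x. c * j x))"
      using f j by (intro quot_norm_le A_scale J_scale)
    also have "(\<lambda>x. c * f x) - (\<lambda>x. c * j x) = (\<lambda>x. c * (f - j) x)"
      by (rule ext) (simp add: fun_apply algebra_simps)
    also have "N \<dots> = cmod c * N (f - j)" using f j by (intro N_scale A_diff_J)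
    finally show "quot_norm (\<lambda>x. c * f x) \<le> cmod c * N (f - j)" .
  qed (use J_0 in auto)
  show ?thesis
  proof (cases "c = 0")
    case True
    then show ?thesis using quot_norm_0 by (simp add: zero_fun_def)
  next
    case False
    then have "quot_norm f \<le> cmod (1 / c) * quot_norm (\<lambda>x. c * f x)"
      using le[OF A_scale[OF f], of "1 / c" c] by simp
    then have "cmod c * quot_norm f \<le> quot_norm (\<lambda>x. c * f x)"
      using False by (simp add: norm_divide field_simps)
    then show ?thesis using le[OF f, of c] by simp
  qed
qed

lemma quot_norm_uminus: "f \<in> A \<Longrightarrow> quot_norm (- f) = quot_norm f"
  using quot_norm_scale[of f "-1"] by (simp add: fun_Compl_def)

text \<open>The two infima are taken one after the other, first over representatives of
  \<open>g\<close>, then of \<open>f\<close>.\<close>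

lemma quot_norm_mult:
  assumes f: "f \<in> A" and g: "g \<in> A" shows "quot_norm (f * g) \<le> quot_norm f * quot_norm g"
proof -
  have *: "quot_norm (f * g) \<le> N f * quot_norm g" if f: "f \<in> A" for f
    unfolding quot_norm_def[of g]
  proof (rule le_mult_cINF)
    fix j assume j: "j \<in> J"
    have "quot_norm (f * g) \<le> N (f * g - f * j)" using f g j by (intro quot_norm_le A_mult J_mult)
    also have "f * g - f * j = f * (g - j)" by (simp add: algebra_simps)
    also have "N \<dots> \<le> N f * N (g - j)" using f g j by (intro N_mult A_diff_J)
    finally show "quot_norm (f * g) \<le> N f * N (g - j)" .
  qed (use J_0 N_nonneg[OF f] in auto)
  have "quot_norm (f * g) \<le> quot_norm g * quot_norm f"
    unfolding quot_norm_def[of f]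
  proof (rule le_mult_cINF)
    fix j assume j: "j \<in> J"
    have "f * g - (f - j) * g = g * j" by (simp add: algebra_simps)
    then have "quot_norm (f * g) = quot_norm ((f - j) * g)"
      using f g j J_mult[OF j g] by (intro quot_norm_cong A_mult A_diff_J) auto
    also have "\<dots> \<le> N (f - j) * quot_norm g" using f j by (intro * A_diff_J)
    finally show "quot_norm (f * g) \<le> quot_norm g * N (f - j)" by (simp add: mult.commute)
  qed (use J_0 quot_norm_nonneg[OF g] in auto)
  then show ?thesis by (simp add: mult.commute)
qed

text \<open>An element of \<open>J\<close> at distance less than 1 from the unit would be invertible
  by the Neumann series, which puts 1 into \<open>J\<close>.\<close>

lemma quot_norm_1: "1 \<le> quot_norm 1"
proof (rule quot_norm_greatest)
  fix j assume j: "j \<in> J"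
  show "1 \<le> N (1 - j)"
  proof (rule ccontr)
    assume "\<not> 1 \<le> N (1 - j)"
    then obtain g where "g \<in> A" "g * (1 - (1 - j)) = 1"
      using Neumann[OF A_diff[OF A_1 J_A[OF j]]] by auto
    then have "1 \<in> J" using J_mult[OF j] by force
    then show False using proper by simp
  qed
qed

text \<open>Hahn-Banach for \<open>quot_norm\<close> at the vector 1 gives a real-linear functional;
  passing to its complexification costs the factor 2.\<close>

lemma separating_functional:
  obtains T where "linear_functional A T" "\<And>f. f \<in> A \<Longrightarrow> cmod (T f) \<le> 2 * quot_norm f" "T 1 \<noteq> 0"
proof -
  define scale where "scale = (\<lambda>r (f :: 'a \<Rightarrow> complex) x. complex_of_real r * f x)"
  interpret V: vector_space scale
    by unfold_locales (auto simp: scale_def fun_eq_iff fun_apply algebra_simps)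
  interpret real_subspace scale A
    by unfold_locales (rule V.subspaceI; simp add: scale_def A_0 A_add A_scale)
  have "sublinear quot_norm"
    unfolding sublinear_def by (auto simp: scale_def quot_norm_add quot_norm_scale)
  then obtain T where T: "\<And>f g. f \<in> A \<Longrightarrow> g \<in> A \<Longrightarrow> T (f + g) = T f + T g"
    "\<And>c f. f \<in> A \<Longrightarrow> T (scale c f) = c * T f"
    "\<And>f. f \<in> A \<Longrightarrow> T f \<le> quot_norm f" "T 1 = quot_norm 1"
    using Hahn_Banach_dominated[OF _ A_1] by metis
  have abs: "\<bar>T f\<bar> \<le> quot_norm f" if f: "f \<in> A" for f
  proof -
    have "- f = scale (-1) f" by (auto simp: scale_def fun_apply)
    then have "T (- f) = - T f" using T(2)[OF f, of "-1"] by simp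
    then show ?thesis using T(3)[OF f] T(3)[OF A_uminus[OF f]] quot_norm_uminus[OF f] by simp
  qed
  define T' where "T' = complexify (\<lambda>f. complex_of_real (T f))"
  have "linear_functional A T'"
    unfolding T'_def
    by (rule complexify_linear) (use T(1,2) in \<open>auto simp: scale_def\<close>)
  moreover have "cmod (T' f) \<le> 2 * quot_norm f" if f: "f \<in> A" for f
  proof -
    have "cmod (T' f) \<le> \<bar>T f\<bar> + \<bar>T (\<lambda>x. \<i> * f x)\<bar>"
      unfolding T'_def complexify_def by (rule order_trans[OF norm_triangle_ineq4]) (simp add: norm_mult)
    also have "\<dots> \<le> quot_norm f + quot_norm (\<lambda>x. \<i> * f x)"
      using f by (intro add_mono abs A_scale)
    finally show ?thesis using quot_norm_scale[OF f, of \<i>] by simp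
  qed
  moreover have "Re (T' 1) = quot_norm 1" by (simp add: T'_def complexify_def T(4))
  then have "T' 1 \<noteq> 0" using quot_norm_1 by auto
  ultimately show ?thesis using that by blast
qed

text \<open>Otherwise \<open>g - c\<close> has an inverse \<open>R c\<close> modulo \<open>J\<close>
  for every \<open>c\<close>. Then \<open>T (R c)\<close> is entire and tends to 0 at infinity, so
  it vanishes identically. Since \<open>R c * g\<close> is \<open>c * R c + 1\<close> modulo
  \<open>J\<close>, it follows that \<open>T 1 = T (R c * g)\<close>, which also tends to 0,
  contradicting \<open>T 1 \<noteq> 0\<close>.\<close>

theorem Gelfand_Mazur:
  assumes inverses: "\<And>f. f \<in> A \<Longrightarrow> f \<notin> J \<Longrightarrow> \<exists>r\<in>A. r * f - 1 \<in> J" and g: "g \<in> A"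
  shows "\<exists>c. (\<lambda>x. g x - c) \<in> J"
proof (rule ccontr)
  assume "\<nexists>c. (\<lambda>x. g x - c) \<in> J"
  then have "\<forall>c. \<exists>r\<in>A. r * (\<lambda>x. g x - c) - 1 \<in> J" using inverses A_diff_const[OF g] by blast
  then obtain R where R: "\<And>c. R c \<in> A" "\<And>c. R c * (\<lambda>x. g x - c) - 1 \<in> J" by metis
  obtain T where lin: "linear_functional A T"
    and bound: "\<And>f. f \<in> A \<Longrightarrow> cmod (T f) \<le> 2 * quot_norm f" and "T 1 \<noteq> 0"
    using separating_functional by blast
  have T_add: "T (f + h) = T f + T h" if "f \<in> A" "h \<in> A" for f h
    using lin that by (auto simp: linear_functional_def)
  have T_scale: "T (\<lambda>x. c * f x) = c * T f" if "f \<in> A" for c f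
    using lin that by (auto simp: linear_functional_def)
  have T_cong: "T f = T h" if "f \<in> A" "h \<in> A" "f - h \<in> J" for f h
  proof -
    have "T (f - h) = 0" using bound[OF J_A[OF that(3)]] quot_norm_J[OF that(3)] by simp
    then show ?thesis using T_add[OF J_A[OF that(3)] that(2)] by simp
  qed
  define d where "d c = quot_norm (R c)" for c
  have d_nonneg: "d c \<ge> 0" for c unfolding d_def using R by (intro quot_norm_nonneg)
  \<comment> \<open>The resolvent identity modulo \<open>J\<close>: each defining relation is
    multiplied by the other resolvent.\<close>
  have resolvent: "R c - R b - (\<lambda>x. (c - b) * (R c * R b) x) \<in> J" for b c
  proof -
    have "R b * (R c * (\<lambda>x. g x - c) - 1) - R c * (R b * (\<lambda>x. g x - b) - 1) \<in> J"
      by (rule J_diff[OF J_mult[OF R(2) R(1)] J_mult[OF R(2) R(1)]])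
    also have "R b * (R c * (\<lambda>x. g x - c) - 1) - R c * (R b * (\<lambda>x. g x - b) - 1)
        = R c - R b - (\<lambda>x. (c - b) * (R c * R b) x)"
      by (rule ext) (simp add: fun_apply algebra_simps)
    finally show ?thesis .
  qed
  \<comment> \<open>Local boundedness: the resolvent identity gives d c <= d b + |c - b| d b d c,
    and the last term is absorbed on the left.\<close>
  have d_near: "d c \<le> 2 * d b" if "cmod (c - b) * d b \<le> 1 / 2" for b c
  proof -
    have "d c = quot_norm (R b + (\<lambda>x. (c - b) * (R c * R b) x))"
      unfolding d_def using R resolvent[of c b]
      by (intro quot_norm_cong A_closed) (auto simp: algebra_simps)
    also have "\<dots> \<le> d b + quot_norm (\<lambda>x. (c - b) * (R c * R b) x)"
      unfolding d_def using R by (intro quot_norm_add A_closed)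
    also have "\<dots> = d b + cmod (c - b) * quot_norm (R c * R b)"
      using R by (simp add: quot_norm_scale A_mult)
    also have "\<dots> \<le> d b + cmod (c - b) * (d c * d b)"
      unfolding d_def using R by (intro add_left_mono mult_left_mono quot_norm_mult) auto
    also have "\<dots> = d b + (cmod (c - b) * d b) * d c" by simp
    also have "\<dots> \<le> d b + 1 / 2 * d c" using that d_nonneg by (intro add_left_mono mult_right_mono)
    finally show ?thesis by simp
  qed
  have deriv: "((\<lambda>c. T (R c)) has_field_derivative T (R b * R b)) (at b)" for b
  proof (rule has_field_derivative_quadratic_bound)
    show "1 / (2 * (d b + 1)) > 0" using d_nonneg[of b] by simp
    fix c assume "cmod (c - b) < 1 / (2 * (d b + 1))"
    then have "cmod (c - b) * (d b + 1) \<le> 1 / 2" using d_nonneg[of b] by (simp add: field_simps)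
    then have "cmod (c - b) * d b \<le> 1 / 2"
      by (smt (verit) mult_left_mono norm_ge_zero)
    then have near: "d c \<le> 2 * d b" by (rule d_near)
    let ?S = "\<lambda>x. (c - b) * (R b * R b) x" and ?Q = "\<lambda>x. (c - b)\<^sup>2 * (R c * (R b * R b)) x"
    \<comment> \<open>Substituting the resolvent identity into itself gives \<open>R c\<close> as
      \<open>R b\<close> plus the linear term \<open>?S\<close> plus the quadratic remainder
      \<open>?Q\<close>, modulo \<open>J\<close>.\<close>
    have "(R c - R b - (\<lambda>x. (c - b) * (R c * R b) x))
        + (\<lambda>x. (c - b) * (R b * (R c - R b - (\<lambda>x. (c - b) * (R c * R b) x))) x) \<in> J"
      using resolvent R by (intro J_add J_scale J_mult)
    also have "(R c - R b - (\<lambda>x. (c - b) * (R c * R b) x))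
        + (\<lambda>x. (c - b) * (R b * (R c - R b - (\<lambda>x. (c - b) * (R c * R b) x))) x)
        = R c - ((R b + ?S) + ?Q)"
      by (rule ext) (simp add: fun_apply algebra_simps power2_eq_square)
    finally have "T (R c) = T ((R b + ?S) + ?Q)"
      using R by (intro T_cong A_closed)
    also have "\<dots> = T (R b) + (c - b) * T (R b * R b) + (c - b)\<^sup>2 * T (R c * (R b * R b))"
      using R by (simp add: T_add T_scale A_add A_mult A_scale)
    finally have "cmod (T (R c) - T (R b) - (c - b) * T (R b * R b))
        = (cmod (c - b))\<^sup>2 * cmod (T (R c * (R b * R b)))"
      by (simp add: norm_mult norm_power)
    also have "\<dots> \<le> (cmod (c - b))\<^sup>2 * (2 * (2 * d b * quot_norm (R b * R b)))"
    proof (rule mult_left_mono)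
      have "cmod (T (R c * (R b * R b))) \<le> 2 * quot_norm (R c * (R b * R b))"
        using R by (intro bound A_mult)
      also have "quot_norm (R c * (R b * R b)) \<le> d c * quot_norm (R b * R b)"
        unfolding d_def using R by (intro quot_norm_mult A_mult)
      also have "\<dots> \<le> 2 * d b * quot_norm (R b * R b)"
        using R near by (intro mult_right_mono quot_norm_nonneg A_mult)
      finally show "cmod (T (R c * (R b * R b))) \<le> 2 * (2 * d b * quot_norm (R b * R b))" by simp
    qed simp
    finally show "cmod (T (R c) - T (R b) - (c - b) * T (R b * R b))
        \<le> 2 * (2 * d b * quot_norm (R b * R b)) * (cmod (c - b))\<^sup>2"
      by (simp add: mult.commute)
  qed
  have shift: "R c * g - (\<lambda>x. c * R c x) - 1 \<in> J" for c
  proof -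
    have "R c * (\<lambda>x. g x - c) - 1 = R c * g - (\<lambda>x. c * R c x) - 1"
      by (rule ext) (simp add: fun_apply algebra_simps)
    then show ?thesis using R(2)[of c] by simp
  qed
  \<comment> \<open>Decay at infinity, from \<open>c * R c\<close> being \<open>R c * g - 1\<close>
    modulo \<open>J\<close>.\<close>
  have d_far: "d c \<le> quot_norm 1 / k" if c: "cmod c \<ge> quot_norm g + k" and k: "k > 0" for c k
  proof -
    have "cmod c * d c = quot_norm (\<lambda>x. c * R c x)" unfolding d_def using R by (simp add: quot_norm_scale)
    also have "\<dots> = quot_norm (R c * g - 1)"
    proof (rule quot_norm_cong)
      have "- (R c * g - (\<lambda>x. c * R c x) - 1) \<in> J" using shift by (intro J_uminus)
      then show "(\<lambda>x. c * R c x) - (R c * g - 1) \<in> J" by (simp add: algebra_simps)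
    qed (use R g in \<open>auto intro!: A_closed\<close>)
    also have "\<dots> \<le> quot_norm (R c * g) + quot_norm 1"
      using quot_norm_add[of "R c * g" "- 1"] R g quot_norm_uminus[OF A_1] by (simp add: A_mult A_uminus A_1)
    also have "\<dots> \<le> d c * quot_norm g + quot_norm 1"
      unfolding d_def using R g by (intro add_right_mono quot_norm_mult)
    finally have "(cmod c - quot_norm g) * d c \<le> quot_norm 1" by (simp add: algebra_simps)
    moreover have "k * d c \<le> (cmod c - quot_norm g) * d c"
      using c d_nonneg by (intro mult_right_mono) auto
    ultimately show ?thesis using k by (simp add: field_simps)
  qed
  have TR: "T (R c) = 0" for c
  proof (rule Liouville_weak_0[where f = "\<lambda>c. T (R c)"])
    show "(\<lambda>c. T (R c)) holomorphic_on UNIV"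
      using deriv by (meson holomorphic_onI field_differentiable_def has_field_derivative_at_within)
    show "((\<lambda>c. T (R c)) \<longlongrightarrow> 0) at_infinity"
    proof (rule tendstoI)
      fix e :: real assume e: "e > 0"
      define k where "k = 2 * quot_norm 1 / e + 1"
      have k: "k > 0" using e quot_norm_1 by (simp add: k_def add_pos_pos)
      have "cmod (T (R c)) < e" if "cmod c \<ge> quot_norm g + k" for c
      proof -
        have "cmod (T (R c)) \<le> 2 * (quot_norm 1 / k)"
          using bound[OF R(1), of c] d_far[OF that k] by (simp add: d_def)
        also have "\<dots> < e" using e k by (simp add: k_def field_simps)
        finally show ?thesis .
      qed
      then show "\<forall>\<^sub>F c in at_infinity. dist (T (R c)) 0 < e"
        unfolding eventually_at_infinity by auto
    qed
  qed
  have "cmod (T 1) \<le> 2 * quot_norm 1 * quot_norm g / k" if k: "k > 0" for k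
  proof -
    define c where "c = complex_of_real (quot_norm g + k)"
    have c: "cmod c \<ge> quot_norm g + k" by (simp only: c_def norm_of_real abs_ge_self)
    have "T (R c * g) = T ((\<lambda>x. c * R c x) + 1)"
      using shift[of c] R g by (intro T_cong A_closed) (auto simp: algebra_simps)
    then have "T 1 = T (R c * g)" using TR[of c] R by (simp add: T_add T_scale A_scale A_1)
    then have "cmod (T 1) \<le> 2 * quot_norm (R c * g)" using bound[of "R c * g"] R g by (simp add: A_mult)
    also have "quot_norm (R c * g) \<le> d c * quot_norm g" unfolding d_def using R g by (intro quot_norm_mult)
    also have "\<dots> \<le> quot_norm 1 / k * quot_norm g"
      using d_far[OF c k] g by (intro mult_right_mono quot_norm_nonneg)
    finally show ?thesis by simp
  qed
  then have "cmod (T 1) * k \<le> 2 * quot_norm 1 * quot_norm g" if "k > 0" for k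
    using that by (simp add: field_simps)
  from this[of "(2 * quot_norm 1 * quot_norm g + 1) / cmod (T 1)"] show False
    using \<open>T 1 \<noteq> 0\<close> quot_norm_1 quot_norm_nonneg[OF g] by (simp add: add_nonneg_pos)
qed

text \<open>The residue \<open>c\<close> of \<open>f\<close> is unique, as two of them would differ
  by a nonzero constant in \<open>J\<close>. Uniqueness makes the residue additive, homogeneous and
  multiplicative.\<close>

lemma character_of_ideal:
  assumes c: "\<And>f. f \<in> A \<Longrightarrow> \<exists>c. (\<lambda>x. f x - c) \<in> J"
  obtains \<psi> where "algebra_character A \<psi>" "\<And>f. f \<in> J \<Longrightarrow> \<psi> f = 0"
proof -
  obtain \<psi> where \<psi>: "\<And>f. f \<in> A \<Longrightarrow> (\<lambda>x. f x - \<psi> f) \<in> J" using c by metis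
  have unique: "\<psi> f = c" if "f \<in> A" "(\<lambda>x. f x - c) \<in> J" for f c
  proof (rule ccontr)
    assume "\<psi> f \<noteq> c"
    have "(\<lambda>x. f x - c) - (\<lambda>x. f x - \<psi> f) \<in> J" using \<psi> that by (intro J_diff)
    also have "(\<lambda>x. f x - c) - (\<lambda>x. f x - \<psi> f) = (\<lambda>_. \<psi> f - c)" by (rule ext) (simp add: fun_apply)
    finally have "(\<lambda>x. 1 / (\<psi> f - c) * (\<psi> f - c)) \<in> J" by (rule J_scale)
    then have "1 \<in> J" using \<open>\<psi> f \<noteq> c\<close> by (simp add: one_fun_def)
    then show False using proper by simp
  qed
  have "\<psi> (f + g) = \<psi> f + \<psi> g" if fg: "f \<in> A" "g \<in> A" for f g
  proof (rule unique)
    have "(\<lambda>x. f x - \<psi> f) + (\<lambda>x. g x - \<psi> g) \<in> J" using \<psi> fg by (intro J_add)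
    also have "(\<lambda>x. f x - \<psi> f) + (\<lambda>x. g x - \<psi> g) = (\<lambda>x. (f + g) x - (\<psi> f + \<psi> g))"
      by (rule ext) (simp add: fun_apply)
    finally show "(\<lambda>x. (f + g) x - (\<psi> f + \<psi> g)) \<in> J" .
  qed (use fg A_add in auto)
  moreover have "\<psi> (\<lambda>x. c * f x) = c * \<psi> f" if f: "f \<in> A" for c f
    using J_scale[OF \<psi>[OF f], of c] f by (intro unique A_scale) (auto simp: right_diff_distrib)
  moreover have "\<psi> (f * g) = \<psi> f * \<psi> g" if fg: "f \<in> A" "g \<in> A" for f g
  proof (rule unique)
    have "g * (\<lambda>x. f x - \<psi> f) + (\<lambda>x. \<psi> f * (g x - \<psi> g)) \<in> J"
      using \<psi> fg by (intro J_add J_mult J_scale)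
    also have "g * (\<lambda>x. f x - \<psi> f) + (\<lambda>x. \<psi> f * (g x - \<psi> g)) = (\<lambda>x. (f * g) x - \<psi> f * \<psi> g)"
      by (rule ext) (simp add: fun_apply algebra_simps)
    finally show "(\<lambda>x. (f * g) x - \<psi> f * \<psi> g) \<in> J" .
  qed (use fg A_mult in auto)
  moreover have "\<psi> 1 = 1"
    using J_0 by (intro unique A_1) (simp add: zero_fun_def one_fun_apply)
  ultimately have "algebra_character A \<psi>"
    unfolding algebra_character_def linear_functional_def multiplicative_def
    using A_1 by (metis zero_neq_one)
  moreover have "\<psi> f = 0" if "f \<in> J" for f using that by (intro unique J_A) auto
  ultimately show ?thesis using that by blast
qed

end

context compact_bfa
begin

text \<open>A noninvertible \<open>f\<close> generates a proper ideal, which lies in a maximal ideal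
  \<open>J\<close>. The quotient by \<open>J\<close> is a field, hence the complex numbers by
  \<open>Gelfand_Mazur\<close>, so some character vanishes on \<open>J\<close>. By naturality it is
  evaluation at a point, where \<open>f\<close> must vanish.\<close>

lemma nonvanishing_invertible:
  assumes natural: "natural_algebra A" and f: "f \<in> A" and nz: "\<And>x. f x \<noteq> 0"
  shows "\<exists>g\<in>A. g * f = 1"
proof (rule ccontr)
  assume not_inv: "\<not> (\<exists>g\<in>A. g * f = 1)"
  define I where "I = (\<lambda>g. g * f) ` A"
  have "fun_ideal I"
    unfolding fun_ideal_def
  proof (intro conjI ballI)
    show "I \<subseteq> A" unfolding I_def using f A_mult by blast
    show "0 \<in> I" unfolding I_def using A_0 by (rule rev_image_eqI) simp
    show "u + v \<in> I" if uv: "u \<in> I" "v \<in> I" for u v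
    proof -
      obtain g h where "g \<in> A" "h \<in> A" "u = g * f" "v = h * f" using uv by (auto simp: I_def)
      then show ?thesis unfolding I_def by (intro rev_image_eqI[of "g + h"] A_add) (auto simp: distrib_right)
    qed
    show "h * u \<in> I" if uh: "u \<in> I" "h \<in> A" for u h
    proof -
      obtain g where "g \<in> A" "u = g * f" using uh by (auto simp: I_def)
      then show ?thesis unfolding I_def using uh by (intro rev_image_eqI[of "h * g"] A_mult) (auto simp: mult.assoc)
    qed
  qed
  moreover have "1 \<notin> I" using not_inv by (auto simp: I_def)
  ultimately obtain J where J: "fun_ideal J" "1 \<notin> J" "I \<subseteq> J"
    and max: "\<And>K. fun_ideal K \<Longrightarrow> 1 \<notin> K \<Longrightarrow> J \<subseteq> K \<Longrightarrow> K = J"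
    using maximal_ideal_exists by metis
  interpret proper_fun_ideal A N J by unfold_locales (use J in auto)
  have "\<exists>r\<in>A. r * g - 1 \<in> J" if g: "g \<in> A" "g \<notin> J" for g
  proof -
    \<comment> \<open>The ideal generated by \<open>J\<close> and \<open>g\<close>; maximality puts
      1 into it, and the coefficient \<open>r\<close> is the inverse of \<open>g\<close> modulo
      \<open>J\<close>.\<close>
    define K where "K = {j + r * g | j r. j \<in> J \<and> r \<in> A}"
    have K_I: "j + r * g \<in> K" if "j \<in> J" "r \<in> A" for j r using that unfolding K_def by blast
    have "fun_ideal K"
      unfolding fun_ideal_def
    proof (intro conjI ballI)
      show "K \<subseteq> A" unfolding K_def using g J_A by (auto intro!: A_add A_mult)
      show "0 \<in> K" using K_I[OF J_0 A_0] by simp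
      show "u + v \<in> K" if uv: "u \<in> K" "v \<in> K" for u v
      proof -
        obtain i r j s where ij: "i \<in> J" "r \<in> A" "u = i + r * g" "j \<in> J" "s \<in> A" "v = j + s * g"
          using uv by (auto simp: K_def)
        then show ?thesis using K_I[OF J_add[OF ij(1,4)] A_add[OF ij(2,5)]] by (simp add: algebra_simps)
      qed
      show "h * u \<in> K" if uh: "u \<in> K" "h \<in> A" for u h
      proof -
        obtain j r where jr: "j \<in> J" "r \<in> A" "u = j + r * g" using uh by (auto simp: K_def)
        then show ?thesis using K_I[OF J_mult[OF jr(1) uh(2)] A_mult[OF uh(2) jr(2)]]
          by (simp add: algebra_simps)
      qed
    qed
    moreover have "J \<subseteq> K" using K_I[OF _ A_0] by auto
    moreover have "K \<noteq> J" using K_I[OF J_0 A_1] g by auto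
    ultimately have "1 \<in> K" using max by blast
    then obtain j r where jr: "j \<in> J" "r \<in> A" "1 = j + r * g" by (auto simp: K_def)
    have "j = 1 - r * g" using jr(3)[symmetric] by (rule eq_diff_eq[THEN iffD2])
    then have "r * g - 1 = - j" by simp
    then show ?thesis using jr(2) J_uminus[OF jr(1)] by (intro bexI[of _ r]) auto
  qed
  then obtain \<psi> where \<psi>: "algebra_character A \<psi>" "\<And>f. f \<in> J \<Longrightarrow> \<psi> f = 0"
    using character_of_ideal[OF Gelfand_Mazur] by metis
  then obtain x where x: "\<And>h. h \<in> A \<Longrightarrow> \<psi> h = h x" using natural by (auto simp: natural_algebra_def)
  have "f \<in> I" unfolding I_def using A_1 by (rule rev_image_eqI) simp
  then have "f x = 0" using x[OF f] \<psi>(2) J(3) by auto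
  then show False using nz by simp
qed

lemma spectrum_subset_range:
  assumes natural: "natural_algebra A" and f: "f \<in> A" and c: "c \<in> spectrum A f"
  shows "c \<in> range f"
proof (rule ccontr)
  assume "c \<notin> range f"
  then have "((\<lambda>_. c) - f) x \<noteq> 0" for x by (auto simp: fun_apply)
  moreover have in_A: "(\<lambda>_. c) - f \<in> A" using f by (intro A_closed)
  ultimately obtain g where "g \<in> A" "g * ((\<lambda>_. c) - f) = 1"
    using nonvanishing_invertible[OF natural] by blast
  then have "(\<lambda>_. c) - f \<in> inv_group A"
    using in_A unfolding Units_def function_ring_def by (auto simp: mult.commute)
  then show False using c by (simp add: spectrum_def)
qed

end

subsection \<open>Additive spectral functionals\<close>

context compact_bfa
begin

text \<open>With \<open>u = (w - z) g\<close> the first-order remainder is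
  \<open>exp (z g) (exp u - 1 - u) h\<close>, of order |w - z|^2 uniformly on the space, and
  \<open>L\<close> is bounded in the sup norm. The factor \<open>h\<close> is what the proof of
  multiplicativity needs; elsewhere it is 1.\<close>

lemma functional_exp_derivative:
  assumes lin: "linear_functional A L" and bound: "\<And>f. f \<in> A \<Longrightarrow> cmod (L f) \<le> sup_norm f"
    and g: "g \<in> A" and h: "h \<in> A"
  shows "((\<lambda>z. L ((\<lambda>x. exp (z * g x)) * h)) has_field_derivative L ((\<lambda>x. exp (z * g x)) * (g * h))) (at z)"
proof (rule has_field_derivative_quadratic_bound[of 1])
  fix w assume w: "cmod (w - z) < 1"
  have E: "(\<lambda>x. exp (z * g x)) \<in> A" for z using g by (intro exp_in_A A_scale)
  have L_add: "L (f + g) = L f + L g" and L_scale: "L (\<lambda>x. c * f x) = c * L f"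
    if "f \<in> A" "g \<in> A" for f g c
    using lin that by (auto simp: linear_functional_def)
  let ?D = "(\<lambda>x. (w - z) * ((\<lambda>x. exp (z * g x)) * (g * h)) x)"
  let ?Q = "(\<lambda>x. exp (w * g x)) * h - ((\<lambda>x. exp (z * g x)) * h + ?D)"
  let ?K = "exp (cmod z * sup_norm g) * exp (sup_norm g) * (sup_norm g)\<^sup>2 * sup_norm h"
  have in_A: "(\<lambda>x. exp (w * g x)) * h \<in> A" "(\<lambda>x. exp (z * g x)) * h \<in> A" "?D \<in> A"
    using g h E by (auto intro!: A_mult A_scale)
  have Q: "?Q \<in> A" using in_A by (intro A_diff A_add)
  have "?Q + ((\<lambda>x. exp (z * g x)) * h + ?D) = (\<lambda>x. exp (w * g x)) * h" by simp
  then have "L ((\<lambda>x. exp (w * g x)) * h) = L ?Q + L ((\<lambda>x. exp (z * g x)) * h + ?D)"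
    using L_add[OF Q A_add[OF in_A(2,3)]] by simp
  also have "L ((\<lambda>x. exp (z * g x)) * h + ?D)
      = L ((\<lambda>x. exp (z * g x)) * h) + (w - z) * L ((\<lambda>x. exp (z * g x)) * (g * h))"
    using L_add[OF in_A(2,3)] L_scale[OF A_mult[OF E A_mult[OF g h]]] g by simp
  finally have "cmod (L ((\<lambda>x. exp (w * g x)) * h) - L ((\<lambda>x. exp (z * g x)) * h)
      - (w - z) * L ((\<lambda>x. exp (z * g x)) * (g * h))) = cmod (L ?Q)" by simp
  also have "\<dots> \<le> sup_norm ?Q" by (rule bound[OF Q])
  also have "\<dots> \<le> ?K * (cmod (w - z))\<^sup>2"
  proof (rule sup_norm_le)
    fix x
    define u where "u = (w - z) * g x"
    have gx: "cmod (g x) \<le> sup_norm g" and hx: "cmod (h x) \<le> sup_norm h"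
      using cmod_le_sup_norm g h by auto
    have sg: "sup_norm g \<ge> 0" using sup_norm_nonneg[OF g] .
    have "w * g x = z * g x + u" by (simp add: u_def algebra_simps)
    then have exp_w: "exp (w * g x) = exp (z * g x) * exp u" by (simp only: exp_add)
    have "?Q x = exp (w * g x) * h x - (exp (z * g x) * h x + u * (exp (z * g x) * h x))"
      by (simp add: fun_apply u_def algebra_simps)
    then have "?Q x = exp (z * g x) * (exp u - 1 - u) * h x"
      by (simp add: exp_w algebra_simps)
    then have "cmod (?Q x) = cmod (exp (z * g x)) * cmod (exp u - 1 - u) * cmod (h x)"
      by (simp add: norm_mult)
    also have "\<dots> \<le> exp (cmod z * sup_norm g)
        * (exp (sup_norm g) * ((cmod (w - z))\<^sup>2 * (sup_norm g)\<^sup>2)) * sup_norm h"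
    proof (intro mult_mono mult_nonneg_nonneg)
      have "cmod (exp (z * g x)) \<le> exp (cmod (z * g x))" by (rule norm_exp)
      also have "\<dots> \<le> exp (cmod z * sup_norm g)" using gx by (simp add: norm_mult mult_left_mono)
      finally show "cmod (exp (z * g x)) \<le> exp (cmod z * sup_norm g)" .
      have "cmod u \<le> 1 * sup_norm g"
        unfolding u_def norm_mult using w gx by (intro mult_mono) auto
      then have Re: "\<bar>Re u\<bar> \<le> sup_norm g" using abs_Re_le_cmod[of u] by linarith
      have le: "cmod u \<le> cmod (w - z) * sup_norm g"
        unfolding u_def norm_mult using gx by (intro mult_left_mono) auto
      then have sq: "(cmod u)\<^sup>2 \<le> (cmod (w - z))\<^sup>2 * (sup_norm g)\<^sup>2"
        using power_mono[OF le norm_ge_zero, of 2] by (simp add: power_mult_distrib)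
      have "cmod (exp u - 1 - u) \<le> exp \<bar>Re u\<bar> * (cmod u)\<^sup>2"
        using Taylor_exp[of u 1] by (simp add: power2_eq_square algebra_simps)
      also have "\<dots> \<le> exp (sup_norm g) * ((cmod (w - z))\<^sup>2 * (sup_norm g)\<^sup>2)"
        using Re sq by (intro mult_mono) auto
      finally show "cmod (exp u - 1 - u) \<le> exp (sup_norm g) * ((cmod (w - z))\<^sup>2 * (sup_norm g)\<^sup>2)" .
    qed (use hx in auto)
    finally show "cmod (?Q x) \<le> ?K * (cmod (w - z))\<^sup>2" by (simp add: mult_ac)
  qed
  finally show "cmod (L ((\<lambda>x. exp (w * g x)) * h) - L ((\<lambda>x. exp (z * g x)) * h)
      - (w - z) * L ((\<lambda>x. exp (z * g x)) * (g * h))) \<le> ?K * (cmod (w - z))\<^sup>2" .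
qed simp

lemma functional_exp_holomorphic:
  assumes lin: "linear_functional A L" and bound: "\<And>f. f \<in> A \<Longrightarrow> cmod (L f) \<le> sup_norm f"
    and g: "g \<in> A" and h: "h \<in> A"
  shows "(\<lambda>z. L ((\<lambda>x. exp (z * g x)) * h)) holomorphic_on UNIV"
proof (rule holomorphic_onI)
  fix z
  have "((\<lambda>z. L ((\<lambda>x. exp (z * g x)) * h)) has_field_derivative L ((\<lambda>x. exp (z * g x)) * (g * h))) (at z)"
    using lin bound g h by (rule functional_exp_derivative)
  then show "(\<lambda>z. L ((\<lambda>x. exp (z * g x)) * h)) field_differentiable at z"
    by (auto simp: field_differentiable_def)
qed

end

locale natural_bfa = compact_bfa +
  assumes natural: "natural_algebra A"

locale additive_spectral = natural_bfa +
  fixes \<Phi> :: "('a \<Rightarrow> complex) \<Rightarrow> complex"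
  assumes additive: "\<And>f g. f \<in> A \<Longrightarrow> g \<in> A \<Longrightarrow> \<Phi> (f + g) = \<Phi> f + \<Phi> g"
    and in_range: "\<And>f. f \<in> A \<Longrightarrow> \<Phi> f \<in> range f"
begin

lemma cmod_\<Phi>_le: "f \<in> A \<Longrightarrow> cmod (\<Phi> f) \<le> sup_norm f"
  using in_range[of f] cmod_le_sup_norm[of f] by auto

lemma cmod_\<Phi>_scale_le: "f \<in> A \<Longrightarrow> cmod (\<Phi> (\<lambda>x. c * f x)) \<le> cmod c * sup_norm f"
  using in_range[OF A_scale, of f c] cmod_le_sup_norm[of f] by (auto simp: norm_mult mult_left_mono)

lemma \<Phi>_nonzero: "f \<in> A \<Longrightarrow> (\<And>x. f x \<noteq> 0) \<Longrightarrow> \<Phi> f \<noteq> 0"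
  using in_range by fastforce

lemma \<Phi>_const: "\<Phi> (\<lambda>_. c) = c"
  using in_range[OF A_const] by auto

lemma \<Phi>_uminus: "f \<in> A \<Longrightarrow> \<Phi> (- f) = - \<Phi> f"
  using additive[OF _ A_uminus, of f f] \<Phi>_const[of 0] by (simp add: zero_fun_def add_eq_0_iff)

lemma \<Phi>_scale_nat: "f \<in> A \<Longrightarrow> \<Phi> (\<lambda>x. of_nat n * f x) = of_nat n * \<Phi> f"
proof (induction n)
  case 0
  then show ?case using \<Phi>_const[of 0] by simp
next
  case (Suc n)
  have "(\<lambda>x. of_nat (Suc n) * f x) = f + (\<lambda>x. of_nat n * f x)"
    by (rule ext) (simp add: fun_apply algebra_simps)
  then show ?case using Suc additive[OF Suc.prems A_scale[OF Suc.prems]] by (simp add: algebra_simps)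
qed

lemma \<Phi>_scale_int: "f \<in> A \<Longrightarrow> \<Phi> (\<lambda>x. of_int m * f x) = of_int m * \<Phi> f"
proof (cases m rule: int_cases2)
  case (nonpos n)
  assume f: "f \<in> A"
  have "(\<lambda>x. of_int m * f x) = - (\<lambda>x. of_nat n * f x)"
    by (rule ext) (simp add: fun_apply nonpos)
  then show ?thesis using \<Phi>_uminus[OF A_scale[OF f]] \<Phi>_scale_nat[OF f] nonpos by simp
qed (simp add: \<Phi>_scale_nat)

text \<open>Additivity gives only integer homogeneity, and boundedness of \<open>\<Phi>\<close>
  supplies the rest. If \<open>D\<close> is the defect at \<open>t\<close>, then \<open>n D\<close>
  is the defect at the fractional part \<open>s\<close> of \<open>n t\<close>, so n |D| <= 2 sup |f|
  for every \<open>n\<close>, whence D = 0.\<close>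

lemma \<Phi>_scale_real:
  assumes f: "f \<in> A" shows "\<Phi> (\<lambda>x. of_real t * f x) = of_real t * \<Phi> f"
proof (rule ccontr)
  define D where "D = \<Phi> (\<lambda>x. of_real t * f x) - of_real t * \<Phi> f"
  assume "\<Phi> (\<lambda>x. of_real t * f x) \<noteq> of_real t * \<Phi> f"
  then have "cmod D > 0" by (simp add: D_def)
  then obtain n :: nat where n: "2 * sup_norm f < n * cmod D"
    using reals_Archimedean3 by blast
  define m where "m = \<lfloor>n * t\<rfloor>"
  define s where "s = n * t - m"
  have s: "0 \<le> s" "s \<le> 1" unfolding s_def m_def by linarith+
  have "(\<lambda>x. of_nat n * (of_real t * f x)) = (\<lambda>x. of_int m * f x) + (\<lambda>x. of_real s * f x)"
    by (rule ext) (simp add: fun_apply s_def algebra_simps)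
  then have "of_nat n * \<Phi> (\<lambda>x. of_real t * f x) = of_int m * \<Phi> f + \<Phi> (\<lambda>x. of_real s * f x)"
    using \<Phi>_scale_nat[OF A_scale[OF f], of n "of_real t"] \<Phi>_scale_int[OF f, of m]
      additive[OF A_scale[OF f] A_scale[OF f], of "of_int m" "of_real s"] by simp
  then have "of_nat n * D = \<Phi> (\<lambda>x. of_real s * f x) - of_real s * \<Phi> f"
    unfolding D_def s_def by (simp add: algebra_simps)
  then have "n * cmod D = cmod (\<Phi> (\<lambda>x. of_real s * f x) - of_real s * \<Phi> f)"
    by (metis norm_mult norm_of_nat)
  also have "\<dots> \<le> cmod (of_real s) * sup_norm f + cmod (of_real s) * sup_norm f"
    using cmod_\<Phi>_scale_le[OF f, of "of_real s"] mult_left_mono[OF cmod_\<Phi>_le[OF f], of s] s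
    by (intro order_trans[OF norm_triangle_ineq4] add_mono) (auto simp: norm_mult)
  also have "\<dots> \<le> 2 * sup_norm f"
    using s mult_right_mono[of s 1 "sup_norm f"] sup_norm_nonneg[OF f] by simp
  finally show False using n by simp
qed

text \<open>The complex-linear part of \<open>\<Phi>\<close>, and the conjugate of its conjugate-linear part.\<close>

definition L :: "('a \<Rightarrow> complex) \<Rightarrow> complex" where
  "L f = complexify \<Phi> f / 2"

definition M :: "('a \<Rightarrow> complex) \<Rightarrow> complex" where
  "M f = complexify (\<lambda>f. cnj (\<Phi> f)) f / 2"

lemma \<Phi>_decomp: "\<Phi> f = L f + cnj (M f)"
  unfolding L_def M_def complexify_def by (simp add: complex_eq_iff field_simps)

lemma L_linear: "linear_functional A L"
  using complexify_linear[of \<Phi>] additive \<Phi>_scale_real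
  unfolding linear_functional_def L_def by (simp add: add_divide_distrib)

lemma M_linear: "linear_functional A M"
  using complexify_linear[of "\<lambda>f. cnj (\<Phi> f)"] additive \<Phi>_scale_real
  unfolding linear_functional_def M_def by (simp add: add_divide_distrib)

lemma cmod_L_le: "f \<in> A \<Longrightarrow> cmod (L f) \<le> sup_norm f"
  and cmod_M_le: "f \<in> A \<Longrightarrow> cmod (M f) \<le> sup_norm f"
proof -
  assume f: "f \<in> A"
  show "cmod (L f) \<le> sup_norm f"
    using norm_triangle_ineq4[of "\<Phi> f" "\<i> * \<Phi> (\<lambda>x. \<i> * f x)"] cmod_\<Phi>_le[OF f]
      cmod_\<Phi>_scale_le[OF f, of \<i>] by (simp add: L_def complexify_def norm_divide norm_mult)
  show "cmod (M f) \<le> sup_norm f"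
    using norm_triangle_ineq4[of "cnj (\<Phi> f)" "\<i> * cnj (\<Phi> (\<lambda>x. \<i> * f x))"] cmod_\<Phi>_le[OF f]
      cmod_\<Phi>_scale_le[OF f, of \<i>] by (simp add: M_def complexify_def norm_divide norm_mult)
qed

lemma L_1: "L 1 = 1" and M_1: "M 1 = 0"
  using \<Phi>_const[of 1] \<Phi>_const[of \<i>]
  by (simp_all add: L_def M_def complexify_def one_fun_def one_fun_apply)

text \<open>Otherwise some rotation \<open>u f\<close> with \<open>\<bar>u\<bar> = 1\<close> would satisfy \<open>\<Phi> (u f) = u L f + cnj (u M f) = 0\<close>.\<close>

lemma cmod_L_neq_M:
  assumes f: "f \<in> A" and nz: "\<And>x. f x \<noteq> 0" shows "cmod (L f) \<noteq> cmod (M f)"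
proof
  assume eq: "cmod (L f) = cmod (M f)"
  \<comment> \<open>Multiplied by \<open>u\<close>, the desired equation
    \<open>u * L f + cnj (u * M f) = 0\<close> becomes
    \<open>u\<^sup>2 * L f + cnj (M f) = 0\<close>, so \<open>u\<close> is a square root of a number
    of modulus 1.\<close>
  obtain u where u: "cmod u = 1" "u\<^sup>2 * L f = - cnj (M f)"
  proof (cases "L f = 0")
    case True
    then show ?thesis using eq that[of 1] by simp
  next
    case False
    define u where "u = csqrt (- cnj (M f) / L f)"
    have sq: "u\<^sup>2 = - cnj (M f) / L f" by (simp add: u_def)
    then have "(cmod u)\<^sup>2 = cmod (- cnj (M f) / L f)" by (metis norm_power)
    also have "\<dots> = 1" using eq False by (auto simp: norm_divide)
    finally have "cmod u = 1" by (simp add: power2_eq_1_iff) (smt (verit) norm_ge_zero)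
    then show ?thesis using sq False that[of u] by simp
  qed
  have "cnj u * u = 1" using u(1) by (metis complex_norm_square mult.commute of_real_1 power_one)
  then have "u * (u * L f + cnj (u * M f)) = u\<^sup>2 * L f + cnj (M f)"
    by (simp add: power2_eq_square algebra_simps)
  then have "u * L f + cnj (u * M f) = 0" using u by auto
  then have "\<Phi> (\<lambda>x. u * f x) = 0"
    using L_linear M_linear f by (simp add: \<Phi>_decomp linear_functional_def)
  moreover have "u * f x \<noteq> 0" for x using u(1) nz[of x] by auto
  ultimately show False using \<Phi>_nonzero[OF A_scale[OF f]] by blast
qed

lemma exp_scale_in_A: "g \<in> A \<Longrightarrow> (\<lambda>x. exp (z * g x)) \<in> A"
  by (intro exp_in_A A_scale)

text \<open>The moduli of \<open>L\<close> and \<open>M\<close> never agree at the nonvanishing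
  functions \<open>exp (z g)\<close>, and at \<open>z = 0\<close> they are 1 and 0, so by continuity
  \<open>M\<close> stays the smaller one for all \<open>z\<close>. Once Liouville's theorem gives
  \<open>M (exp (z g)) = 0\<close>, the derivative at 0 is \<open>M g = 0\<close>.\<close>

lemma M_eq_0:
  assumes g: "g \<in> A" shows "M g = 0"
proof -
  define E where "E z = (\<lambda>x. exp (z * g x)) * 1" for z
  have E: "E z \<in> A" for z unfolding E_def using g by (intro A_mult exp_scale_in_A A_1)
  have holo_L: "(\<lambda>z. L (E z)) holomorphic_on UNIV"
    unfolding E_def by (rule functional_exp_holomorphic; fact L_linear cmod_L_le g A_1)
  have holo_M: "(\<lambda>z. M (E z)) holomorphic_on UNIV"
    unfolding E_def by (rule functional_exp_holomorphic; fact M_linear cmod_M_le g A_1)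
  note holo = holo_L holo_M
  have E0: "E 0 = 1" by (rule ext) (simp add: E_def fun_apply)
  have neq: "cmod (L (E z)) \<noteq> cmod (M (E z))" for z
    using E by (rule cmod_L_neq_M) (simp add: E_def fun_apply)
  have less: "cmod (M (E z)) < cmod (L (E z))" for z
  proof (rule ccontr)
    assume not_less: "\<not> cmod (M (E z)) < cmod (L (E z))"
    define p where "p w = cmod (L (E w)) - cmod (M (E w))" for w
    have "continuous_on UNIV p" unfolding p_def
      using holo[THEN holomorphic_on_imp_continuous_on] by (intro continuous_intros)
    \<comment> \<open>The intermediate value theorem on the segment from 0 to \<open>z\<close> would
      produce a point where the moduli agree.\<close>
    then have "continuous_on {0..1} (\<lambda>t. p (of_real t * z))"
      by (rule continuous_on_compose2) (auto intro!: continuous_intros)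
    moreover have "p (of_real 1 * z) \<le> 0" "0 \<le> p (of_real 0 * z)"
      using not_less by (auto simp: p_def E0 L_1 M_1)
    ultimately obtain t where "p (of_real t * z) = 0"
      using IVT2'[of "\<lambda>t. p (of_real t * z)" 1 0 0] by auto
    then show False using neq by (simp add: p_def)
  qed
  then have nz: "L (E z) \<noteq> 0" for z using less[of z] by (metis norm_ge_zero norm_zero not_less)
  have "(\<lambda>z. M (E z) / L (E z)) constant_on UNIV"
  proof (rule Liouville_theorem)
    show "(\<lambda>z. M (E z) / L (E z)) holomorphic_on UNIV"
      using holo nz by (intro holomorphic_intros) auto
    have "cmod (M (E z) / L (E z)) \<le> 1" for z
      using less[of z] nz[of z] by (simp add: norm_divide divide_le_eq_1)
    then show "bounded (range (\<lambda>z. M (E z) / L (E z)))"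
      by (intro boundedI[of _ 1]) auto
  qed
  then obtain c where c: "\<And>z. M (E z) / L (E z) = c" unfolding constant_on_def by blast
  have "c = 0" using c[of 0] by (simp add: E0 M_1)
  then have "M (E z) = 0" for z using c[of z] nz[of z] by simp
  then have "((\<lambda>z. M (E z)) has_field_derivative 0) (at 0)" by simp
  moreover have "((\<lambda>z. M (E z)) has_field_derivative M ((\<lambda>x. exp (0 * g x)) * (g * 1))) (at 0)"
    unfolding E_def using M_linear cmod_M_le g A_1 by (rule functional_exp_derivative)
  ultimately have "M ((\<lambda>x. exp (0 * g x)) * (g * 1)) = 0" by (metis DERIV_unique)
  moreover have "(\<lambda>x. exp (0 * g x)) * (g * 1) = g" by (rule ext) (simp add: fun_apply)
  ultimately show ?thesis by simp
qed

lemma \<Phi>_linear: "linear_functional A \<Phi>"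
proof -
  have "\<Phi> f = L f" if "f \<in> A" for f using \<Phi>_decomp M_eq_0[OF that] by simp
  then show ?thesis using L_linear by (simp add: linear_functional_def A_add A_scale)
qed

text \<open>
  For fixed \<open>f\<close> and \<open>g\<close> the quotient \<open>\<Phi> (exp (z g) f) / \<Phi> (exp (z g))\<close> is a value of \<open>f\<close>, hence
  it is a bounded entire function of \<open>z\<close>.
\<close>

lemma \<Phi>_mult:
  assumes f: "f \<in> A" and g: "g \<in> A" shows "\<Phi> (g * f) = \<Phi> g * \<Phi> f"
proof -
  define E where "E z = (\<lambda>x. exp (z * g x))" for z
  have E: "E z \<in> A" for z unfolding E_def using g by (rule exp_scale_in_A)
  have holo: "(\<lambda>z. \<Phi> (E z * h)) holomorphic_on UNIV" if "h \<in> A" for h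
    unfolding E_def using that g \<Phi>_linear cmod_\<Phi>_le by (intro functional_exp_holomorphic)
  have nz: "\<Phi> (E z * 1) \<noteq> 0" for z
    using E by (intro \<Phi>_nonzero A_mult A_1) (auto simp: E_def fun_apply)
  have quotient_range: "\<Phi> (E z * f) / \<Phi> (E z * 1) \<in> range f" for z
  proof -
    \<comment> \<open>This choice gives \<open>\<Phi> (E z * (f - c)) = 0\<close>, so
      \<open>E z * (f - c)\<close> has a zero; as \<open>E z\<close> has none, \<open>c\<close> is a
      value of \<open>f\<close>.\<close>
    define c where "c = \<Phi> (E z * f) / \<Phi> (E z * 1)"
    have "E z * (\<lambda>x. f x - c) + (\<lambda>x. c * (E z * 1) x) = E z * f"
      by (rule ext) (simp add: fun_apply algebra_simps)
    then have "\<Phi> (E z * f) = \<Phi> (E z * (\<lambda>x. f x - c)) + c * \<Phi> (E z * 1)"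
      using \<Phi>_linear E f additive[of "E z * (\<lambda>x. f x - c)" "\<lambda>x. c * (E z * 1) x"]
      by (simp add: linear_functional_def A_mult A_1 A_scale A_diff_const)
    then have "\<Phi> (E z * (\<lambda>x. f x - c)) = 0" using nz by (simp add: c_def)
    then obtain x where "(E z * (\<lambda>x. f x - c)) x = 0"
      using \<Phi>_nonzero[OF A_mult[OF E A_diff_const[OF f]]] by metis
    then have "f x = c" by (simp add: E_def fun_apply)
    then show ?thesis unfolding c_def by (metis rangeI)
  qed
  have "(\<lambda>z. \<Phi> (E z * f) / \<Phi> (E z * 1)) constant_on UNIV"
  proof (rule Liouville_theorem)
    show "(\<lambda>z. \<Phi> (E z * f) / \<Phi> (E z * 1)) holomorphic_on UNIV"
      using holo[OF f] holo[OF A_1] nz by (intro holomorphic_intros)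
    have "cmod (\<Phi> (E z * f) / \<Phi> (E z * 1)) \<le> sup_norm f" for z
      using quotient_range[of z] cmod_le_sup_norm[OF f] by (metis imageE)
    then show "bounded (range (\<lambda>z. \<Phi> (E z * f) / \<Phi> (E z * 1)))"
      by (intro boundedI[of _ "sup_norm f"]) auto
  qed
  then obtain c where c: "\<And>z. \<Phi> (E z * f) / \<Phi> (E z * 1) = c" unfolding constant_on_def by blast
  have E0: "E 0 * h = h" for h by (rule ext) (simp add: E_def fun_apply)
  have "c = \<Phi> f" using c[of 0] \<Phi>_const[of 1] by (simp add: E0 one_fun_def)
  then have eq: "\<Phi> (E z * f) = \<Phi> (E z * 1) * \<Phi> f" for z
    using c[of z] nz[of z] by (simp add: field_simps)
  \<comment> \<open>Differentiating \<open>eq\<close> at 0 brings down \<open>g\<close> on both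
    sides.\<close>
  have deriv: "((\<lambda>z. \<Phi> (E z * h)) has_field_derivative \<Phi> (E 0 * (g * h))) (at 0)" if "h \<in> A" for h
    unfolding E_def using \<Phi>_linear cmod_\<Phi>_le g that by (rule functional_exp_derivative)
  have "((\<lambda>z. \<Phi> (E z * 1) * \<Phi> f) has_field_derivative \<Phi> (E 0 * (g * 1)) * \<Phi> f) (at 0)"
    by (intro DERIV_cmult_right deriv A_1)
  then have "((\<lambda>z. \<Phi> (E z * f)) has_field_derivative \<Phi> (E 0 * (g * 1)) * \<Phi> f) (at 0)"
    unfolding eq .
  then have "\<Phi> (E 0 * (g * f)) = \<Phi> (E 0 * (g * 1)) * \<Phi> f" using deriv[OF f] by (metis DERIV_unique)
  then show ?thesis by (simp add: E0)
qed

theorem Kowalski_Slodkowski: "\<exists>x. \<forall>f\<in>A. \<Phi> f = f x"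
proof -
  have "\<Phi> 1 \<noteq> 0" using \<Phi>_const[of 1] by (simp add: one_fun_def)
  then have "algebra_character A \<Phi>"
    unfolding algebra_character_def multiplicative_def
    using \<Phi>_linear \<Phi>_mult A_1 by blast
  then show ?thesis using natural by (simp add: natural_algebra_def)
qed

end

section \<open>Logarithms of a multiplicative spectral function on exponentials\<close>

locale multiplicative_spectral = natural_bfa +
  fixes \<phi> :: "('a \<Rightarrow> complex) \<Rightarrow> complex"
  assumes mult: "multiplicative A \<phi>" and spec: "spectral A \<phi>"
begin

lemma \<phi>_mult: "f \<in> A \<Longrightarrow> g \<in> A \<Longrightarrow> \<phi> (f * g) = \<phi> f * \<phi> g"
  using mult by (simp add: multiplicative_def)

lemma \<phi>_range: "f \<in> A \<Longrightarrow> \<phi> f \<in> range f"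
  using spec spectrum_subset_range[OF natural] by (auto simp: spectral_def)

lemma \<phi>_const: "\<phi> (\<lambda>_. c) = c"
  using \<phi>_range[OF A_const] by auto

lemma \<phi>_scale: "f \<in> A \<Longrightarrow> \<phi> (\<lambda>x. c * f x) = c * \<phi> f"
  using \<phi>_mult[OF A_const, of f c] \<phi>_const[of c] by (simp add: times_fun_def)

lemma \<phi>_power: "f \<in> A \<Longrightarrow> \<phi> (f ^ n) = \<phi> f ^ n"
  using \<phi>_const[of 1] by (induction n) (auto simp: one_fun_def \<phi>_mult A_power)

definition log_\<phi> :: "('a \<Rightarrow> complex) \<Rightarrow> complex" where
  "log_\<phi> f = Ln (\<phi> (\<lambda>x. exp (f x)))"

lemma log_\<phi>_range:
  assumes f: "f \<in> A" and small: "\<And>x. cmod (f x) < pi"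
  shows "log_\<phi> f \<in> range f" "exp (log_\<phi> f) = \<phi> (\<lambda>x. exp (f x))"
proof -
  obtain y where y: "\<phi> (\<lambda>x. exp (f x)) = exp (f y)" using \<phi>_range[OF exp_in_A[OF f]] by blast
  have "\<bar>Im (f y)\<bar> < pi" using small[of y] abs_Im_le_cmod[of "f y"] by linarith
  then have "Ln (exp (f y)) = f y" by (intro Ln_exp) auto
  then show "log_\<phi> f \<in> range f" "exp (log_\<phi> f) = \<phi> (\<lambda>x. exp (f x))"
    by (simp_all add: log_\<phi>_def y)
qed

text \<open>The two logarithms are values \<open>f y\<close> and \<open>g z\<close> at possibly
  different points. The bound pi / 2 keeps the imaginary part of their sum below pi, where the
  principal logarithm inverts \<open>exp\<close>.\<close>

lemma log_\<phi>_add: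
  assumes f: "f \<in> A" "\<And>x. cmod (f x) < pi / 2" and g: "g \<in> A" "\<And>x. cmod (g x) < pi / 2"
  shows "log_\<phi> (f + g) = log_\<phi> f + log_\<phi> g"
proof -
  have fp: "cmod (f x) < pi" and gp: "cmod (g x) < pi" for x
    using f(2)[of x] g(2)[of x] norm_ge_zero[of "f x"] norm_ge_zero[of "g x"] by linarith+
  obtain y z where y: "log_\<phi> f = f y" and z: "log_\<phi> g = g z"
    using log_\<phi>_range(1)[OF f(1) fp] log_\<phi>_range(1)[OF g(1) gp] by blast
  have "(\<lambda>x. exp ((f + g) x)) = (\<lambda>x. exp (f x)) * (\<lambda>x. exp (g x))"
    by (rule ext) (simp add: fun_apply exp_add)
  then have "\<phi> (\<lambda>x. exp ((f + g) x)) = exp (log_\<phi> f + log_\<phi> g)"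
    using f g log_\<phi>_range(2)[OF f(1) fp] log_\<phi>_range(2)[OF g(1) gp]
    by (simp add: \<phi>_mult exp_in_A exp_add)
  moreover have "\<bar>Im (f y + g z)\<bar> < pi"
    using f(2)[of y] g(2)[of z] abs_Im_le_cmod[of "f y"] abs_Im_le_cmod[of "g z"] by simp
  then have "Ln (exp (f y + g z)) = f y + g z" by (intro Ln_exp) auto
  ultimately show ?thesis unfolding y z by (simp add: log_\<phi>_def[of "f + g"])
qed

lemma log_\<phi>_scale:
  assumes f: "f \<in> A" and small: "\<And>x. real m * cmod (f x) < pi / 2" and m: "m > 0"
  shows "log_\<phi> (\<lambda>x. of_nat m * f x) = of_nat m * log_\<phi> f"
  using m small
proof (induction m rule: nat_induct_non_zero)
  case (Suc m)
  have le: "real m * cmod (f x) < pi / 2" "cmod (f x) < pi / 2" for x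
  proof -
    have "real m * cmod (f x) \<le> real (Suc m) * cmod (f x)" "1 * cmod (f x) \<le> real (Suc m) * cmod (f x)"
      by (intro mult_right_mono; simp)+
    then show "real m * cmod (f x) < pi / 2" "cmod (f x) < pi / 2" using Suc.prems[of x] by auto
  qed
  have "(\<lambda>x. of_nat (Suc m) * f x) = f + (\<lambda>x. of_nat m * f x)"
    by (rule ext) (simp add: fun_apply algebra_simps)
  moreover have "log_\<phi> (f + (\<lambda>x. of_nat m * f x)) = log_\<phi> f + log_\<phi> (\<lambda>x. of_nat m * f x)"
    using f le by (intro log_\<phi>_add A_scale) (auto simp: norm_mult)
  ultimately show ?case using Suc.IH le by (simp only: of_nat_Suc distrib_right mult_1)
qed simp

text \<open>Dividing by an integer above the sup norm brings \<open>f\<close> into the range where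
  \<open>log_\<phi>\<close> is additive; \<open>Suc\<close> keeps the divisor nonzero. By
  \<open>\<Lambda>_eq\<close> any positive integer bounding \<open>f\<close> gives the same
  value.\<close>

definition \<Lambda> :: "('a \<Rightarrow> complex) \<Rightarrow> complex" where
  "\<Lambda> f = (let n = Suc (nat \<lceil>sup_norm f\<rceil>) in of_nat n * log_\<phi> (\<lambda>x. 1 / of_nat n * f x))"

text \<open>The scales \<open>n\<close> and \<open>m\<close> are compared through their common
  refinement \<open>n * m\<close>.\<close>

lemma \<Lambda>_eq:
  assumes f: "f \<in> A" and le: "\<And>x. cmod (f x) \<le> real n" and n: "n > 0"
  shows "\<Lambda> f = of_nat n * log_\<phi> (\<lambda>x. 1 / of_nat n * f x)"
proof -
  have *: "log_\<phi> (\<lambda>x. 1 / of_nat n * f x) = of_nat m * log_\<phi> (\<lambda>x. 1 / of_nat (n * m) * f x)"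
    if "\<And>x. cmod (f x) \<le> real n" "n > 0" "m > 0" for m n :: nat
  proof -
    have eq: "(\<lambda>x. 1 / of_nat n * f x) = (\<lambda>x. of_nat m * (1 / of_nat (n * m) * f x))"
      using that by (auto simp: field_simps)
    have "log_\<phi> (\<lambda>x. of_nat m * (1 / of_nat (n * m) * f x)) = of_nat m * log_\<phi> (\<lambda>x. 1 / of_nat (n * m) * f x)"
    proof (rule log_\<phi>_scale[OF A_scale[OF f]])
      fix x
      have "real m * cmod (1 / of_nat (n * m) * f x) = cmod (f x) / real n"
        using that by (simp add: norm_mult norm_divide)
      also have "\<dots> \<le> 1" using that by (simp add: divide_le_eq)
      also have "\<dots> < pi / 2" using pi_gt3 by simp
      finally show "real m * cmod (1 / of_nat (n * m) * f x) < pi / 2" .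
    qed (use that in simp)
    then show ?thesis by (simp only: eq)
  qed
  define m where "m = Suc (nat \<lceil>sup_norm f\<rceil>)"
  have m: "m > 0" "cmod (f x) \<le> real m" for x
    using cmod_le_sup_norm[OF f, of x] by (auto simp: m_def) linarith
  have "\<Lambda> f = of_nat m * log_\<phi> (\<lambda>x. 1 / of_nat m * f x)"
    unfolding \<Lambda>_def m_def Let_def ..
  also have "\<dots> = of_nat n * log_\<phi> (\<lambda>x. 1 / of_nat n * f x)"
    using *[OF m(2,1) n] *[OF le n m(1)] by (simp add: mult_ac)
  finally show ?thesis .
qed

lemma common_bound:
  assumes "f \<in> A" "g \<in> A"
  shows "\<exists>n>0. (\<forall>x. cmod (f x) \<le> real n) \<and> (\<forall>x. cmod (g x) \<le> real n) \<and> (\<forall>x. cmod ((f + g) x) \<le> real n)"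
proof -
  obtain n :: nat where n: "sup_norm f + sup_norm g < real n" using reals_Archimedean2 by blast
  have nonneg: "sup_norm f \<ge> 0" "sup_norm g \<ge> 0" using assms sup_norm_nonneg by auto
  have le: "cmod (f x) \<le> sup_norm f" "cmod (g x) \<le> sup_norm g" for x
    using assms cmod_le_sup_norm by auto
  have "cmod (f x) \<le> real n" "cmod (g x) \<le> real n" for x
    using le[of x] n nonneg by auto
  moreover have "cmod ((f + g) x) \<le> real n" for x
    using norm_triangle_ineq[of "f x" "g x"] le[of x] n by (simp add: fun_apply)
  moreover have "n > 0" using n nonneg by (intro Nat.gr0I) auto
  ultimately show ?thesis by blast
qed

lemma \<Lambda>_scaled_small: "n > 0 \<Longrightarrow> cmod z \<le> real n \<Longrightarrow> cmod (1 / of_nat n * z) < pi / 2"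
proof -
  assume "n > 0" "cmod z \<le> real n"
  then have "cmod (1 / of_nat n * z) \<le> 1" by (simp add: norm_mult norm_divide divide_le_eq_1)
  then show ?thesis using pi_gt3 by linarith
qed

text \<open>One integer bounding \<open>f\<close>, \<open>g\<close> and \<open>f + g\<close> lets
  all three values be computed at the same scale.\<close>

sublocale \<Lambda>: additive_spectral A N \<Lambda>
proof unfold_locales
  fix f g assume fg: "f \<in> A" "g \<in> A"
  obtain n where n: "n > 0" "\<And>x. cmod (f x) \<le> real n" "\<And>x. cmod (g x) \<le> real n"
    "\<And>x. cmod ((f + g) x) \<le> real n" 
    using common_bound[OF fg] by blast
  have "(\<lambda>x. 1 / of_nat n * (f + g) x) = (\<lambda>x. 1 / of_nat n * f x) + (\<lambda>x. 1 / of_nat n * g x)"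
    by (rule ext) (simp add: fun_apply add_divide_distrib)
  then have "log_\<phi> (\<lambda>x. 1 / of_nat n * (f + g) x)
      = log_\<phi> (\<lambda>x. 1 / of_nat n * f x) + log_\<phi> (\<lambda>x. 1 / of_nat n * g x)"
    using fg n by (simp only:) (intro log_\<phi>_add A_scale \<Lambda>_scaled_small)
  then show "\<Lambda> (f + g) = \<Lambda> f + \<Lambda> g"
    using fg n by (simp only: \<Lambda>_eq[OF _ _ n(1)] A_add distrib_left)
next
  fix f assume f: "f \<in> A"
  obtain n where n: "n > 0" "\<And>x. cmod (f x) \<le> real n" 
    using common_bound[OF f f] by blast
  have "cmod (1 / of_nat n * f x) < pi" for x
    using \<Lambda>_scaled_small[OF n(1) n(2), of x] pi_gt_zero by linarith
  then obtain y where "log_\<phi> (\<lambda>x. 1 / of_nat n * f x) = 1 / of_nat n * f y"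
    using log_\<phi>_range(1)[OF A_scale[OF f]] by blast
  then have "\<Lambda> f = f y" using \<Lambda>_eq[OF f n(2,1)] n(1) by simp
  then show "\<Lambda> f \<in> range f" by simp
qed

text \<open>\<open>exp f\<close> is the \<open>n\<close>-th power of \<open>exp (f / n)\<close>, and
  \<open>f / n\<close> is small enough for \<open>log_\<phi>\<close>.\<close>

lemma \<phi>_exp:
  assumes f: "f \<in> A" shows "\<phi> (\<lambda>x. exp (f x)) = exp (\<Lambda> f)"
proof -
  obtain n where n: "n > 0" "\<And>x. cmod (f x) \<le> real n" 
    using common_bound[OF f f] by blast
  define g where "g = (\<lambda>x. 1 / of_nat n * f x)"
  have g: "g \<in> A" unfolding g_def using f by (rule A_scale)
  have small: "cmod (g x) < pi" for x
    using \<Lambda>_scaled_small[OF n(1) n(2), of x] pi_gt_zero unfolding g_def by linarith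
  have "(\<lambda>x. exp (f x)) = (\<lambda>x. exp (g x)) ^ n"
    using n(1) by (intro ext) (simp add: power_fun_apply g_def flip: exp_of_nat_mult)
  then have "\<phi> (\<lambda>x. exp (f x)) = exp (log_\<phi> g) ^ n"
    using log_\<phi>_range(2)[OF g small] exp_in_A[OF g] by (simp add: \<phi>_power)
  also have "\<dots> = exp (\<Lambda> f)" using \<Lambda>_eq[OF f n(2,1)] by (simp add: g_def exp_of_nat_mult)
  finally show ?thesis .
qed

theorem exp_evaluation: "\<exists>x. \<forall>f\<in>A. \<phi> (\<lambda>y. exp (f y)) = exp (f x)"
  using \<Lambda>.Kowalski_Slodkowski \<phi>_exp by auto

end

subsection \<open>Peaking at points of the Choquet boundary\<close>

text \<open>Continuity is not imposed, because indicators of open sets must belong to the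
  space.\<close>

definition bounded_real_functions :: "('a \<Rightarrow> real) set" where
  "bounded_real_functions = {v. \<exists>c. \<forall>y. \<bar>v y\<bar> \<le> c}"

lemma bounded_real_functionsI: "(\<And>y. \<bar>v y\<bar> \<le> c) \<Longrightarrow> v \<in> bounded_real_functions"
  by (auto simp: bounded_real_functions_def)

lemma bounded_real_functions_add:
  "u \<in> bounded_real_functions \<Longrightarrow> v \<in> bounded_real_functions \<Longrightarrow> u + v \<in> bounded_real_functions"
proof -
  assume "u \<in> bounded_real_functions" "v \<in> bounded_real_functions"
  then obtain c d where cd: "\<And>y. \<bar>u y\<bar> \<le> c" "\<And>y. \<bar>v y\<bar> \<le> d"
    by (auto simp: bounded_real_functions_def)
  show ?thesis
  proof (rule bounded_real_functionsI)
    show "\<bar>(u + v) y\<bar> \<le> c + d" for y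
      using abs_triangle_ineq[of "u y" "v y"] cd[of y] by (simp add: fun_apply)
  qed
qed

lemma bounded_real_functions_scale:
  "v \<in> bounded_real_functions \<Longrightarrow> (\<lambda>y. r * v y) \<in> bounded_real_functions"
proof -
  assume "v \<in> bounded_real_functions"
  then obtain c where c: "\<And>y. \<bar>v y\<bar> \<le> c" by (auto simp: bounded_real_functions_def)
  show ?thesis
    by (rule bounded_real_functionsI[of _ "\<bar>r\<bar> * c"]) (simp add: abs_mult c mult_left_mono)
qed

interpretation bounded_real: real_subspace "\<lambda>r (v :: 'a \<Rightarrow> real) y. r * v y" bounded_real_functions
proof -
  interpret vector_space "\<lambda>r (v :: 'a \<Rightarrow> real) y. r * v y"
    by unfold_locales (auto simp: fun_eq_iff fun_apply algebra_simps)
  show "real_subspace (\<lambda>r (v :: 'a \<Rightarrow> real) y. r * v y) bounded_real_functions"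
    by unfold_locales
      (rule subspaceI; auto intro: bounded_real_functions_add bounded_real_functions_scale
        bounded_real_functionsI[of _ 0] simp: fun_apply)
qed

context compact_bfa
begin

definition majorants :: "('a \<Rightarrow> real) \<Rightarrow> ('a \<Rightarrow> complex) set" where
  "majorants v = {g \<in> A. \<forall>y. v y \<le> Re (g y)}"

text \<open>Linear functionals below this gauge are positive and extend
  \<open>Re f \<mapsto> Re (f x)\<close> from \<open>A\<close>: they are the finitely additive
  analogues of representing measures for \<open>x\<close>.\<close>

definition upper_value :: "'a \<Rightarrow> ('a \<Rightarrow> real) \<Rightarrow> real" where
  "upper_value x v = (INF g\<in>majorants v. Re (g x))"

lemma upper_value_le: "g \<in> A \<Longrightarrow> (\<And>y. v y \<le> Re (g y)) \<Longrightarrow> upper_value x v \<le> Re (g x)"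
  unfolding upper_value_def
  by (rule cINF_lower) (auto simp: majorants_def intro!: bdd_belowI2[of _ "v x"])

lemma majorants_nonempty:
  assumes "v \<in> bounded_real_functions" shows "majorants v \<noteq> {}"
proof -
  obtain c where "\<And>y. \<bar>v y\<bar> \<le> c" using assms by (auto simp: bounded_real_functions_def)
  then have "(\<lambda>_. of_real c) \<in> majorants v"
    using A_const by (auto simp: majorants_def intro: order_trans[OF abs_ge_self])
  then show ?thesis by blast
qed

lemma upper_value_ge: "v \<in> bounded_real_functions \<Longrightarrow> v x \<le> upper_value x v"
  unfolding upper_value_def by (intro cINF_greatest majorants_nonempty) (auto simp: majorants_def)

lemma upper_value_less:
  assumes "v \<in> bounded_real_functions" "upper_value x v < e"
  obtains g where "g \<in> A" "\<And>y. v y \<le> Re (g y)" "Re (g x) < e"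
proof -
  have "\<exists>g\<in>majorants v. Re (g x) < e"
  proof (rule ccontr)
    assume "\<not> (\<exists>g\<in>majorants v. Re (g x) < e)"
    then have "e \<le> upper_value x v"
      unfolding upper_value_def by (intro cINF_greatest majorants_nonempty assms) auto
    then show False using assms by simp
  qed
  then show ?thesis using that by (auto simp: majorants_def)
qed

lemma upper_value_sublinear: "bounded_real.sublinear (upper_value x)"
proof (rule bounded_real.sublinearI)
  fix u v :: "'a \<Rightarrow> real" assume uv: "u \<in> bounded_real_functions" "v \<in> bounded_real_functions"
  show "upper_value x (u + v) \<le> upper_value x u + upper_value x v"
    unfolding upper_value_def[of x u] upper_value_def[of x v]
  proof (rule le_cINF_add)
    fix g h assume gh: "g \<in> majorants u" "h \<in> majorants v"
    then have "upper_value x (u + v) \<le> Re ((g + h) x)"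
      by (intro upper_value_le A_add) (auto simp: majorants_def fun_apply add_mono)
    then show "upper_value x (u + v) \<le> Re (g x) + Re (h x)" by (simp add: fun_apply)
  qed (use uv majorants_nonempty in auto)
next
  fix c :: real and v :: "'a \<Rightarrow> real" assume c: "c > 0" and v: "v \<in> bounded_real_functions"
  show "upper_value x (\<lambda>y. c * v y) \<le> c * upper_value x v"
    unfolding upper_value_def[of x v]
  proof (rule le_mult_cINF)
    fix g assume g: "g \<in> majorants v"
    then have "upper_value x (\<lambda>y. c * v y) \<le> Re (of_real c * g x)"
      using c by (intro upper_value_le A_scale) (auto simp: majorants_def fun_apply)
    then show "upper_value x (\<lambda>y. c * v y) \<le> c * Re (g x)" by (simp add: fun_apply)
  qed (use c v majorants_nonempty in auto)
next
  show "upper_value x 0 = 0"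
  proof (rule antisym)
    show "upper_value x 0 \<le> 0" using upper_value_le[OF A_0, of 0 x] by (simp add: fun_apply)
    show "0 \<le> upper_value x 0"
      using upper_value_ge[of 0 x] bounded_real.V_zero by (simp add: fun_apply)
  qed
qed

lemma Re_bounded: "f \<in> A \<Longrightarrow> (\<lambda>y. Re (f y)) \<in> bounded_real_functions"
  by (rule bounded_real_functionsI[of _ "sup_norm f"])
    (use abs_Re_le_cmod cmod_le_sup_norm order_trans in blast)

end

text \<open>\<open>T\<close> plays the part of integration against a probability measure
  representing \<open>x\<close>; \<open>TC\<close> below is its complex-valued version.\<close>

locale dominated_extension = compact_bfa A N
  for A :: "('a::t2_space \<Rightarrow> complex) set" and N +
  fixes x :: 'a and T :: "('a \<Rightarrow> real) \<Rightarrow> real"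
  assumes T_add: "u \<in> bounded_real_functions \<Longrightarrow> v \<in> bounded_real_functions \<Longrightarrow> T (u + v) = T u + T v"
    and T_scale: "v \<in> bounded_real_functions \<Longrightarrow> T (\<lambda>y. r * v y) = r * T v"
    and T_le: "v \<in> bounded_real_functions \<Longrightarrow> T v \<le> upper_value x v"
begin

lemma T_uminus: "v \<in> bounded_real_functions \<Longrightarrow> T (\<lambda>y. - v y) = - T v"
  using T_scale[of v "-1"] by (simp add: fun_apply)

text \<open>The difference \<open>u - v\<close> is nonpositive, so the zero function is among its
  majorants and \<open>T (u - v) \<le> 0\<close>.\<close>

lemma T_mono:
  assumes "u \<in> bounded_real_functions" "v \<in> bounded_real_functions" "\<And>y. u y \<le> v y"
  shows "T u \<le> T v"
proof -
  have eq: "u = v + (u + (\<lambda>y. - 1 * v y))" by (rule ext) (simp add: fun_apply)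
  have B: "u + (\<lambda>y. - 1 * v y) \<in> bounded_real_functions"
    using assms by (intro bounded_real_functions_add bounded_real_functions_scale)
  have "T (u + (\<lambda>y. - 1 * v y)) \<le> Re ((0 :: 'a \<Rightarrow> complex) x)"
    using assms by (intro order_trans[OF T_le[OF B]] upper_value_le A_0) (auto simp: fun_apply)
  then have "T (u + (\<lambda>y. - 1 * v y)) \<le> 0" by (simp only: fun_apply zero_complex.simps)
  moreover have "T u = T v + T (u + (\<lambda>y. - 1 * v y))"
    using T_add[OF assms(2) B] by (simp only: eq[symmetric])
  ultimately show ?thesis by linarith
qed

text \<open>\<open>f\<close> is a majorant of its own real part and \<open>- f\<close> of the
  negative; the two resulting bounds meet.\<close>

lemma T_Re:
  assumes f: "f \<in> A" shows "T (\<lambda>y. Re (f y)) = Re (f x)"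
proof (rule antisym)
  show "T (\<lambda>y. Re (f y)) \<le> Re (f x)"
    using f by (intro order_trans[OF T_le] upper_value_le Re_bounded) auto
  have "T (\<lambda>y. - Re (f y)) \<le> Re ((- f) x)"
    using f by (intro order_trans[OF T_le] upper_value_le A_uminus)
      (auto simp: fun_apply dest: Re_bounded[OF A_uminus])
  then show "Re (f x) \<le> T (\<lambda>y. Re (f y))"
    using T_uminus[OF Re_bounded[OF f]] by (simp add: fun_apply)
qed

definition TC :: "('a \<Rightarrow> complex) \<Rightarrow> complex" where
  "TC h = Complex (T (\<lambda>y. Re (h y))) (T (\<lambda>y. Im (h y)))"

definition bounded_complex :: "('a \<Rightarrow> complex) \<Rightarrow> bool" where
  "bounded_complex h \<longleftrightarrow> (\<exists>c. \<forall>y. cmod (h y) \<le> c)"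

lemma bounded_complex_Re: "bounded_complex h \<Longrightarrow> (\<lambda>y. Re (h y)) \<in> bounded_real_functions"
  and bounded_complex_Im: "bounded_complex h \<Longrightarrow> (\<lambda>y. Im (h y)) \<in> bounded_real_functions"
  unfolding bounded_complex_def bounded_real_functions_def
  using abs_Re_le_cmod abs_Im_le_cmod by (blast intro: order_trans)+

lemma TC_add:
  assumes "bounded_complex g" "bounded_complex h" shows "TC (g + h) = TC g + TC h"
proof -
  have "(\<lambda>y. Re ((g + h) y)) = (\<lambda>y. Re (g y)) + (\<lambda>y. Re (h y))"
    "(\<lambda>y. Im ((g + h) y)) = (\<lambda>y. Im (g y)) + (\<lambda>y. Im (h y))"
    by (auto simp: fun_apply)
  then show ?thesis
    unfolding TC_def using assms
    by (simp add: T_add bounded_complex_Re bounded_complex_Im complex_eq_iff)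
qed

lemma TC_scale:
  assumes h: "bounded_complex h" shows "TC (\<lambda>y. c * h y) = c * TC h"
proof -
  have "(\<lambda>y. Re (c * h y)) = (\<lambda>y. Re c * Re (h y)) + (\<lambda>y. (- Im c) * Im (h y))"
    "(\<lambda>y. Im (c * h y)) = (\<lambda>y. Re c * Im (h y)) + (\<lambda>y. Im c * Re (h y))"
    by (auto simp: fun_apply)
  then show ?thesis
    unfolding TC_def
    by (simp only: T_add T_scale bounded_real_functions_scale bounded_complex_Re[OF h]
        bounded_complex_Im[OF h]) (simp add: complex_eq_iff)
qed

lemma TC_eval:
  assumes f: "f \<in> A" shows "TC f = f x"
  using T_Re[OF f] T_Re[OF A_scale[OF f, of "- \<i>"]] by (simp add: TC_def complex_eq_iff fun_apply)

text \<open>A rotation \<open>\<omega>\<close> makes \<open>TC h\<close> real and nonnegative, so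
  that monotonicity of \<open>T\<close> applies to the real part.\<close>

lemma cmod_TC_le:
  assumes u: "u \<in> bounded_real_functions" and le: "\<And>y. cmod (h y) \<le> u y"
  shows "cmod (TC h) \<le> T u"
proof -
  have h: "bounded_complex h"
  proof -
    obtain c where "\<And>y. \<bar>u y\<bar> \<le> c" using u by (auto simp: bounded_real_functions_def)
    then have "cmod (h y) \<le> c" for y using le[of y] abs_ge_self[of "u y"] order_trans by meson
    then show ?thesis unfolding bounded_complex_def by blast
  qed
  obtain \<omega> where \<omega>: "cmod \<omega> = 1" "\<omega> * TC h = of_real (cmod (TC h))"
  proof (cases "TC h = 0")
    case True
    then show ?thesis using that[of 1] by simp
  next
    case False
    then show ?thesis
      using that[of "of_real (cmod (TC h)) / TC h"] by (simp add: norm_divide)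
  qed
  have \<omega>h: "bounded_complex (\<lambda>y. \<omega> * h y)"
    using h \<omega> by (simp add: bounded_complex_def norm_mult)
  have "cmod (TC h) = Re (TC (\<lambda>y. \<omega> * h y))" using TC_scale[OF h] \<omega> by simp
  also have "\<dots> = T (\<lambda>y. Re (\<omega> * h y))" by (simp add: TC_def)
  also have "\<dots> \<le> T u"
  proof (rule T_mono[OF bounded_complex_Re[OF \<omega>h] u])
    fix y
    have "Re (\<omega> * h y) \<le> cmod (\<omega> * h y)" by (rule complex_Re_le_cmod)
    then show "Re (\<omega> * h y) \<le> u y" using \<omega>(1) le[of y] by (simp add: norm_mult)
  qed
  finally show ?thesis .
qed

text \<open>
  Splitting \<open>T\<close> along \<open>w\<close> and \<open>1 - w\<close> writes the evaluation at \<open>x\<close> as a convex combination.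
  The factor \<open>1/2\<close> keeps the weights away from \<open>0\<close> and \<open>1\<close>.
\<close>

lemma TC_mult_extreme:
  assumes x: "x \<in> choquet_boundary A"
    and w: "\<And>y. 0 \<le> w y" "\<And>y. w y \<le> 1" and pos: "T w > 0" and f: "f \<in> A"
  shows "TC (\<lambda>y. of_real (w y) * f y) = of_real (T w) * f x"
proof -
  have wB: "w \<in> bounded_real_functions" using w by (intro bounded_real_functionsI[of _ 1]) simp
  have oneB: "(\<lambda>_. 1) \<in> bounded_real_functions" by (rule bounded_real_functionsI[of _ 1]) simp
  have T_1: "T (\<lambda>_. 1) = 1" using T_Re[OF A_1] by (simp add: one_fun_apply)
  have "T w \<le> 1" using T_mono[OF wB oneB w(2)] T_1 by simp
  define s where "s = T w / 2"
  have s: "0 < s" "s < 1" using pos \<open>T w \<le> 1\<close> by (auto simp: s_def)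
  \<comment> \<open>\<open>P\<close> integrates against the normalised weight \<open>w\<close>;
    \<open>Q\<close> is what remains of the evaluation after removing the share \<open>s\<close> of
    \<open>P\<close>.\<close>
  define P where "P f = TC (\<lambda>y. of_real (w y) * f y) / of_real (T w)" for f
  define Q where "Q f = (f x - of_real s * P f) / of_real (1 - s)" for f
  have bdd: "bounded_complex (\<lambda>y. of_real (v y) * f y)"
    if f: "f \<in> A" and v: "v \<in> bounded_real_functions" for f v
  proof -
    obtain c where c: "\<And>y. \<bar>v y\<bar> \<le> c" using v by (auto simp: bounded_real_functions_def)
    have "cmod (of_real (v y) * f y) \<le> c * sup_norm f" for y
      unfolding norm_mult using c cmod_le_sup_norm[OF f, of y] order_trans[OF abs_ge_zero c]
      by (intro mult_mono) auto
    then show ?thesis unfolding bounded_complex_def by blast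
  qed
  have TC_le: "cmod (TC (\<lambda>y. of_real (v y) * f y)) \<le> T v * sup_norm f"
    if "f \<in> A" "v \<in> bounded_real_functions" "\<And>y. 0 \<le> v y" for f v
  proof -
    have "cmod (TC (\<lambda>y. of_real (v y) * f y)) \<le> T (\<lambda>y. sup_norm f * v y)"
      using that cmod_le_sup_norm[OF that(1)]
      by (intro cmod_TC_le bounded_real_functions_scale)
        (auto simp: norm_mult mult.commute[of "sup_norm f"] intro: mult_left_mono)
    then show ?thesis using T_scale[OF that(2)] by (simp add: mult.commute)
  qed
  have P_linear: "linear_functional A P"
    unfolding linear_functional_def
  proof (intro conjI ballI allI)
    fix f g assume "f \<in> A" "g \<in> A"
    moreover have "(\<lambda>y. of_real (w y) * (f + g) y)
        = (\<lambda>y. of_real (w y) * f y) + (\<lambda>y. of_real (w y) * g y)"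
      by (rule ext) (simp add: fun_apply distrib_left)
    ultimately show "P (f + g) = P f + P g"
      using TC_add[OF bdd[OF _ wB] bdd[OF _ wB], of f g] by (simp add: P_def add_divide_distrib)
  next
    fix c f assume "f \<in> A"
    moreover have "(\<lambda>y. of_real (w y) * (c * f y)) = (\<lambda>y. c * (of_real (w y) * f y))"
      by (simp add: mult.left_commute)
    ultimately show "P (\<lambda>y. c * f y) = c * P f"
      using TC_scale[OF bdd[OF _ wB], of f c] by (simp add: P_def)
  qed
  have P_ball: "P \<in> dual_unit_ball A"
    using P_linear TC_le[OF _ wB w(1)] pos
    by (auto simp: dual_unit_ball_def P_def norm_divide divide_le_eq mult.commute)
  have "linear_functional A Q"
    using P_linear unfolding linear_functional_def Q_def
    by (simp add: fun_apply algebra_simps add_divide_distrib diff_divide_distrib)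
  moreover have "cmod (Q f) \<le> sup_norm f" if f: "f \<in> A" for f
  proof -
    \<comment> \<open>The weight behind \<open>Q\<close>: integrating \<open>f\<close> against
      \<open>?v\<close> gives \<open>(1 - s) * Q f\<close>, and \<open>T ?v = 1 - s\<close>, which
      yields the norm bound.\<close>
    let ?v = "\<lambda>y. 1 - w y / 2"
    have vB: "?v \<in> bounded_real_functions"
    proof (rule bounded_real_functionsI[of _ 1])
      show "\<bar>?v y\<bar> \<le> 1" for y using w[of y] by simp
    qed
    have v_eq: "?v = (\<lambda>_. 1) + (\<lambda>y. (- 1 / 2) * w y)" by (rule ext) (simp add: fun_apply)
    have "T ?v = 1 - s"
      unfolding v_eq T_add[OF oneB bounded_real_functions_scale[OF wB]] T_scale[OF wB] T_1
      by (simp add: s_def)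
    have "(\<lambda>y. of_real (?v y) * f y) = f + (\<lambda>y. (- 1 / 2) * (of_real (w y) * f y))"
      by (rule ext) (simp add: fun_apply algebra_simps)
    moreover have "bounded_complex f" using bdd[OF f oneB] by simp
    moreover have "bounded_complex (\<lambda>y. (- 1 / 2) * (of_real (w y) * f y))"
      using bdd[OF f bounded_real_functions_scale[OF wB, of "- 1 / 2"]] by (simp add: mult.assoc)
    ultimately have "TC (\<lambda>y. of_real (?v y) * f y) = f x + (- 1 / 2) * TC (\<lambda>y. of_real (w y) * f y)"
      by (simp only: TC_add TC_scale[OF bdd[OF f wB]] TC_eval[OF f])
    also have "\<dots> = f x - of_real s * P f" using pos by (simp add: P_def s_def)
    finally have "cmod (f x - of_real s * P f) \<le> (1 - s) * sup_norm f"
      using TC_le[OF f vB] w(2) \<open>T ?v = 1 - s\<close> by (simp add: order_trans[OF w(2)])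
    then show ?thesis using s
      unfolding Q_def norm_divide norm_of_real by (simp add: divide_le_eq mult.commute)
  qed
  ultimately have Q_ball: "Q \<in> dual_unit_ball A" by (simp add: dual_unit_ball_def)
  have comb: "f x = of_real (1 - s) * Q f + of_real s * P f" for f
  proof -
    have "complex_of_real (1 - s) \<noteq> 0" using s by simp
    then show ?thesis unfolding Q_def by simp
  qed
  have "extreme_functional A (dual_unit_ball A) (\<lambda>f. f x)"
    using x by (simp add: choquet_boundary_def)
  then have "Q f = P f"
    using Q_ball P_ball s comb f unfolding extreme_functional_def by blast
  then have "f x = P f" using comb[of f] by (simp add: algebra_simps)
  then show ?thesis using pos by (simp add: P_def)
qed

end

section \<open>Peaking functions from extremality\<close>

context compact_bfa
begin

text \<open>Otherwise Hahn-Banach gives a \<open>T\<close> with positive mass on \<open>V\<close>.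
  By \<open>TC_mult_extreme\<close>, integrating \<open>f - f y\<close> over \<open>V\<close> gives
  that mass times \<open>f x - f y\<close>, of modulus \<open>d\<close> times the mass, although |f
  - f y| < d / 2 on \<open>V\<close>.\<close>

lemma upper_value_indicator_eq_0:
  assumes x: "x \<in> choquet_boundary A" and "y \<noteq> x"
  obtains V where "open V" "y \<in> V" "upper_value x (indicator V) = 0"
proof -
  obtain f where f: "f \<in> A" "f x \<noteq> f y" using A_separates \<open>y \<noteq> x\<close> by metis
  define d where "d = cmod (f x - f y)"
  have d: "d > 0" using f by (simp add: d_def)
  define V where "V = {z. cmod (f z - f y) < d / 2}"
  have "open V"
    unfolding V_def using A_cont[OF f(1), of UNIV]
    by (intro open_Collect_less continuous_intros)
  moreover have "y \<in> V" using d by (simp add: V_def)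
  moreover have "upper_value x (indicator V) = 0"
  proof -
    have wB: "indicator V \<in> bounded_real_functions"
      by (rule bounded_real_functionsI[of _ 1]) (simp add: indicator_def)
    obtain T where T: "\<And>u v. u \<in> bounded_real_functions \<Longrightarrow> v \<in> bounded_real_functions \<Longrightarrow> T (u + v) = T u + T v"
      "\<And>c v. v \<in> bounded_real_functions \<Longrightarrow> T (\<lambda>y. c * v y) = c * T v"
      "\<And>v. v \<in> bounded_real_functions \<Longrightarrow> T v \<le> upper_value x v"
      "T (indicator V) = upper_value x (indicator V)"
      using bounded_real.Hahn_Banach_dominated[OF upper_value_sublinear wB] by metis
    interpret dominated_extension A N x T by unfold_locales (use T in auto)
    have nonneg: "T (indicator V) \<ge> 0"
      using upper_value_ge[OF wB, of x] T(4) by (simp add: order_trans[OF indicator_pos_le])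
    show ?thesis
    proof (rule ccontr)
      assume "upper_value x (indicator V) \<noteq> 0"
      then have pos: "T (indicator V) > 0" using nonneg T(4) by simp
      have "f x - f y = (\<lambda>z. f z - f y) x" by simp
      then have "T (indicator V) * d = cmod (TC (\<lambda>z. of_real (indicator V z) * (f z - f y)))"
        using TC_mult_extreme[OF x _ _ pos A_diff_const[OF f(1)], of "f y"] pos
        by (simp add: norm_mult d_def indicator_def)
      also have "\<dots> \<le> T (\<lambda>z. d / 2 * indicator V z)"
        using d by (intro cmod_TC_le bounded_real_functions_scale wB) (auto simp: indicator_def V_def)
      also have "\<dots> = d / 2 * T (indicator V)" by (rule T_scale[OF wB])
      finally show False using pos d by simp
    qed
  qed
  ultimately show ?thesis by (rule that)
qed

text \<open>By compactness finitely many sets from \<open>upper_value_indicator_eq_0\<close> cover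
  the complement of \<open>U\<close>. Each has a majorant of its indicator with small real part at
  \<open>x\<close>; their sum is at least 1 off \<open>U\<close>, and a multiple of it reaches
  \<open>K\<close>.\<close>

lemma Choquet_peaking:
  assumes x: "x \<in> choquet_boundary A" and U: "open U" "x \<in> U" and "e > 0"
  obtains g where "g \<in> A" "\<And>y. 0 \<le> Re (g y)" "\<And>y. y \<notin> U \<Longrightarrow> K \<le> Re (g y)" "Re (g x) < e"
proof -
  have "\<forall>y\<in>- U. \<exists>V. open V \<and> y \<in> V \<and> upper_value x (indicator V) = 0"
    using upper_value_indicator_eq_0[OF x] U by (metis ComplD)
  then obtain V where V: "\<And>y. y \<in> - U \<Longrightarrow> open (V y)" "\<And>y. y \<in> - U \<Longrightarrow> y \<in> V y"
    "\<And>y. y \<in> - U \<Longrightarrow> upper_value x (indicator (V y)) = 0" by metis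
  have "compact (- U)" using compact_UNIV U by (metis Compl_eq_Diff_UNIV compact_diff)
  then obtain F where F: "F \<subseteq> - U" "finite F" "- U \<subseteq> (\<Union>y\<in>F. V y)"
    by (rule compactE_image[of "- U" "- U" V]) (use V(1,2) in blast)+
  have "\<exists>g\<in>A. (\<forall>y. 0 \<le> Re (g y)) \<and> (\<forall>y\<in>\<Union>z\<in>F. V z. 1 \<le> Re (g y)) \<and> Re (g x) < e"
    if "e > 0" for e
    using F(2,1) that
  proof (induction F arbitrary: e rule: finite_induct)
    case empty
    then show ?case using A_0 by (intro bexI[of _ 0]) (auto simp: fun_apply)
  next
    case (insert z F)
    have "\<exists>g\<in>A. (\<forall>y. 0 \<le> Re (g y)) \<and> (\<forall>y\<in>\<Union>z\<in>F. V z. 1 \<le> Re (g y)) \<and> Re (g x) < e / 2"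
      using insert.IH[of "e / 2"] insert.prems by simp
    then obtain g where g: "g \<in> A" "\<And>y. 0 \<le> Re (g y)"
      "\<And>y. y \<in> (\<Union>z\<in>F. V z) \<Longrightarrow> 1 \<le> Re (g y)" "Re (g x) < e / 2"
      by blast
    have wB: "indicator (V z) \<in> bounded_real_functions"
      by (rule bounded_real_functionsI[of _ 1]) (simp add: indicator_def)
    obtain h where h: "h \<in> A" "\<And>y. indicator (V z) y \<le> Re (h y)" "Re (h x) < e / 2"
      using upper_value_less[OF wB, of x "e / 2"] V(3)[of z] insert.prems by auto
    have h0: "0 \<le> Re (h y)" for y using h(2)[of y] by (meson indicator_pos_le order_trans)
    have h1: "1 \<le> Re (h y)" if "y \<in> V z" for y using h(2)[of y] that by simp
    show ?case
    proof (intro bexI[of _ "g + h"] conjI allI ballI)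
      show "0 \<le> Re ((g + h) y)" for y using g(2) h0 by (simp add: fun_apply)
      show "1 \<le> Re ((g + h) y)" if "y \<in> (\<Union>z\<in>insert z F. V z)" for y
        using that g(2)[of y] g(3)[of y] h0[of y] h1[of y] by (force simp: fun_apply)
      show "Re ((g + h) x) < e" using g(4) h(3) by (simp add: fun_apply)
    qed (use g h A_add in auto)
  qed
  \<comment> \<open>\<open>K\<close> may be nonpositive, but the scaling factor has to be positive;
    the target at \<open>x\<close> is therefore \<open>e / k\<close>.\<close>
  moreover define k where "k = max K 1"
  moreover have "e / k > 0" using \<open>e > 0\<close> by (simp add: k_def)
  ultimately obtain g where g: "g \<in> A" "\<And>y. 0 \<le> Re (g y)" "\<And>y. y \<notin> U \<Longrightarrow> 1 \<le> Re (g y)"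
    "Re (g x) < e / k" using F(3) by (metis ComplI subsetD)
  have k: "k \<ge> 1" "K \<le> k" by (auto simp: k_def)
  show ?thesis
  proof (rule that[of "\<lambda>y. of_real k * g y"])
    show "(\<lambda>y. of_real k * g y) \<in> A" using g by (intro A_scale)
    show "0 \<le> Re (of_real k * g y)" for y using g k by simp
    show "K \<le> Re (of_real k * g y)" if "y \<notin> U" for y
    proof -
      have "K \<le> k * 1" using k by simp
      also have "\<dots> \<le> k * Re (g y)" using g(3)[OF that] k by (intro mult_left_mono) auto
      finally show ?thesis by simp
    qed
    show "Re (of_real k * g x) < e" using g(4) k by (simp add: field_simps)
  qed
qed

end

subsection \<open>Multiplicative spectral functions\<close>

context compact_bfa
begin

lemma inv_groupE:
  assumes "f \<in> inv_group A" obtains g where "f \<in> A" "g \<in> A" "g * f = 1"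
  using assms by (auto simp: Units_def function_ring_def)

lemma function_ring_cring: "cring (function_ring A)"
proof (rule cringI)
  show "abelian_group (function_ring A)"
  proof (rule abelian_groupI)
    show "\<exists>g\<in>carrier (function_ring A). g \<oplus>\<^bsub>function_ring A\<^esub> f = \<zero>\<^bsub>function_ring A\<^esub>"
      if "f \<in> carrier (function_ring A)" for f
      using that by (intro bexI[of _ "- f"]) (auto simp: function_ring_def A_uminus)
  qed (auto simp: function_ring_def A_add A_0 add.assoc add.commute)
  show "comm_monoid (function_ring A)"
    by (rule comm_monoidI) (auto simp: function_ring_def A_mult A_1 mult.assoc mult.commute)
qed (auto simp: function_ring_def distrib_right)

text \<open>If a larger ideal contains \<open>f\<close> with \<open>f x \<noteq> 0\<close>, it
  contains \<open>g = f / f x\<close> and also \<open>1 - g\<close>, which vanishes at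
  \<open>x\<close>, hence it contains 1.\<close>

lemma maximalideal_point: "maximalideal {f \<in> A. f x = 0} (function_ring A)"
proof -
  interpret cring "function_ring A" by (rule function_ring_cring)
  show ?thesis
  proof (rule maximalidealI)
    show "ideal {f \<in> A. f x = 0} (function_ring A)"
    proof (rule idealI[OF ring_axioms])
      show "subgroup {f \<in> A. f x = 0} (add_monoid (function_ring A))"
      proof (rule add.subgroupI)
        show "{f \<in> A. f x = 0} \<noteq> {}" using A_0 by auto
        fix f assume f: "f \<in> {f \<in> A. f x = 0}"
        have "\<ominus>\<^bsub>function_ring A\<^esub> f = - f"
          by (rule minus_equality) (use f in \<open>auto simp: function_ring_def A_uminus\<close>)
        then show "\<ominus>\<^bsub>function_ring A\<^esub> f \<in> {f \<in> A. f x = 0}" using f A_uminus by simp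
      qed (auto simp: function_ring_def A_add fun_apply)
    qed (auto simp: function_ring_def A_mult fun_apply)
    show "carrier (function_ring A) \<noteq> {f \<in> A. f x = 0}"
    proof -
      have "1 \<in> carrier (function_ring A)" using A_1 by (simp add: function_ring_def)
      moreover have "1 \<notin> {f \<in> A. f x = 0}" by (simp add: fun_apply)
      ultimately show ?thesis by metis
    qed
    fix J assume J: "ideal J (function_ring A)" "{f \<in> A. f x = 0} \<subseteq> J" "J \<subseteq> carrier (function_ring A)"
    interpret J: ideal J "function_ring A" by (rule J(1))
    show "J = {f \<in> A. f x = 0} \<or> J = carrier (function_ring A)"
    proof (cases "J = {f \<in> A. f x = 0}")
      case False
      then obtain f where f: "f \<in> J" "f \<in> A" "f x \<noteq> 0"
        using J(2,3) by (auto simp: function_ring_def)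
      define g where "g = (\<lambda>_. 1 / f x) * f"
      have "g \<in> J"
        using J.I_l_closed[OF f(1), of "\<lambda>_. 1 / f x"] A_const by (simp add: function_ring_def g_def)
      moreover have "g \<in> A" unfolding g_def using f by (intro A_mult A_const)
      then have "1 - g \<in> J"
        using f by (intro subsetD[OF J(2)]) (simp add: A_diff A_1 g_def fun_apply)
      ultimately have "g + (1 - g) \<in> J"
        using J.a_closed[of g "1 - g"] by (simp add: function_ring_def)
      then have "\<one>\<^bsub>function_ring A\<^esub> \<in> J" by (simp add: function_ring_def)
      then show ?thesis using J.one_imp_carrier by blast
    qed simp
  qed
qed

end

locale choquet_spectral = multiplicative_spectral +
  fixes x\<^sub>0
  assumes choquet: "choquet_boundary A = UNIV"
    and exp_eval: "f \<in> A \<Longrightarrow> \<phi> (\<lambda>y. exp (f y)) = exp (f x\<^sub>0)"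
begin

text \<open>If |f x0| < b < |phi f|, a peaking \<open>g\<close> makes |f exp (- g)| < b everywhere
  while |phi f| exp (- Re g x0) stays at least \<open>b\<close>. This contradicts that phi (f exp (-
  g)) is a value of f exp (- g).\<close>

lemma cmod_\<phi>_le:
  assumes f: "f \<in> A" shows "cmod (\<phi> f) \<le> cmod (f x\<^sub>0)"
proof (rule ccontr)
  assume "\<not> cmod (\<phi> f) \<le> cmod (f x\<^sub>0)"
  then obtain b where b: "cmod (f x\<^sub>0) < b" "b < cmod (\<phi> f)" 
    using dense[of "cmod (f x\<^sub>0)" "cmod (\<phi> f)"] by auto
  then have "b > 0" using norm_ge_zero[of "f x\<^sub>0"] by linarith
  define U where "U = {y. cmod (f y) < b}"
  have U: "open U" "x\<^sub>0 \<in> U"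
    unfolding U_def using A_cont[OF f, of UNIV] b
    by (auto intro!: open_Collect_less continuous_intros)
  define C where "C = sup_norm f + 1"
  have C: "C > 0" using sup_norm_nonneg[OF f] by (simp add: C_def)
  have "ln (cmod (\<phi> f) / b) > 0" using b \<open>b > 0\<close> by (intro ln_gt_zero) (simp add: less_divide_eq)
  \<comment> \<open>The level ln (C / b) off \<open>U\<close> pushes the bound \<open>C\<close> on
    |f| down to \<open>b\<close>; the bound at \<open>x\<^sub>0\<close> keeps |phi f| exp (- Re g)
    above \<open>b\<close>.\<close>
  then obtain g where g: "g \<in> A" "\<And>y. 0 \<le> Re (g y)" "\<And>y. y \<notin> U \<Longrightarrow> ln (C / b) \<le> Re (g y)"
    "Re (g x\<^sub>0) < ln (cmod (\<phi> f) / b)"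
    using Choquet_peaking[OF _ U, of "ln (cmod (\<phi> f) / b)" "ln (C / b)"] choquet by blast
  let ?p = "\<lambda>y. exp ((- g) y)"
  have p: "?p \<in> A" using g by (intro exp_in_A A_uminus)
  obtain y where y: "\<phi> (f * ?p) = (f * ?p) y" using \<phi>_range[OF A_mult[OF f p]] by blast
  have "cmod (f y) * exp (- Re (g y)) < b"
  proof (cases "y \<in> U")
    case True
    have "cmod (f y) * exp (- Re (g y)) \<le> cmod (f y) * 1" using g(2)[of y] by (intro mult_left_mono) auto
    then show ?thesis using True by (simp add: U_def)
  next
    case False
    have "cmod (f y) * exp (- Re (g y)) < C * exp (- Re (g y))"
      using cmod_le_sup_norm[OF f, of y] by (simp add: C_def)
    also have "\<dots> \<le> C * exp (- ln (C / b))" using g(3)[OF False] C by (intro mult_left_mono) auto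
    also have "\<dots> = b" using C \<open>b > 0\<close> by (simp add: exp_minus field_simps)
    finally show ?thesis .
  qed
  then have "cmod (\<phi> (f * ?p)) < b" unfolding y by (simp add: fun_apply norm_mult)
  moreover have "\<phi> (f * ?p) = \<phi> f * exp (- g x\<^sub>0)"
    using \<phi>_mult[OF f p] exp_eval[OF A_uminus[OF g(1)]] by simp
  ultimately have "cmod (\<phi> f) * exp (- Re (g x\<^sub>0)) < b" by (simp add: norm_mult)
  moreover have "b = cmod (\<phi> f) * exp (- ln (cmod (\<phi> f) / b))"
  proof -
    have "\<phi> f \<noteq> 0" using b(2) \<open>b > 0\<close> by auto
    then have "cmod (\<phi> f) / b > 0" using \<open>b > 0\<close> by simp
    then show ?thesis using \<open>\<phi> f \<noteq> 0\<close> by (simp only: exp_minus exp_ln) simp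
  qed
  moreover have "cmod (\<phi> f) * exp (- ln (cmod (\<phi> f) / b)) \<le> cmod (\<phi> f) * exp (- Re (g x\<^sub>0))"
    using g(4) by (intro mult_left_mono) auto
  ultimately show False by linarith
qed

text \<open>Testing the inequality on \<open>exp (c f)\<close> compares
  \<open>Re (c * f x\<^sub>0)\<close> with \<open>Re (c * f x)\<close>; the four values 1, -1, i, -i
  of \<open>c\<close> force \<open>f x = f x\<^sub>0\<close>.\<close>

lemma bound_point_unique:
  assumes x: "\<And>f. f \<in> A \<Longrightarrow> cmod (\<phi> f) \<le> cmod (f x)" shows "x = x\<^sub>0"
proof (rule ccontr)
  assume "x \<noteq> x\<^sub>0"
  then obtain f where f: "f \<in> A" "f x \<noteq> f x\<^sub>0" using A_separates by blast
  have le: "Re (c * f x\<^sub>0) \<le> Re (c * f x)" for c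
    using x[OF exp_in_A[OF A_scale[OF f(1), of c]]] exp_eval[OF A_scale[OF f(1), of c]] by simp
  have "f x = f x\<^sub>0"
    using le[of 1] le[of "-1"] le[of \<i>] le[of "- \<i>"] by (simp add: complex_eq_iff)
  then show False using f by simp
qed

text \<open>The inequality holds for \<open>f\<close> and for its inverse, and the products of the
  moduli are 1 on both sides, so it cannot be strict.\<close>

lemma cmod_\<phi>_inv_group:
  assumes "f \<in> inv_group A" shows "cmod (\<phi> f) = cmod (f x\<^sub>0)"
proof -
  obtain g where fg: "f \<in> A" "g \<in> A" "g * f = 1" using assms by (rule inv_groupE)
  have "\<phi> g * \<phi> f = 1" using \<phi>_mult[OF fg(2,1)] fg(3) \<phi>_const[of 1] by (simp add: one_fun_def)
  then have "cmod (\<phi> g) * cmod (\<phi> f) = 1" by (simp flip: norm_mult)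
  moreover have "(g * f) x\<^sub>0 = 1" by (simp add: fg(3) fun_apply)
  then have "g x\<^sub>0 * f x\<^sub>0 = 1" by (simp add: fun_apply)
  then have "cmod (g x\<^sub>0) * cmod (f x\<^sub>0) = 1" by (simp flip: norm_mult)
  moreover have "cmod (\<phi> g) * cmod (\<phi> f) \<le> cmod (g x\<^sub>0) * cmod (\<phi> f)"
    using cmod_\<phi>_le[OF fg(2)] by (intro mult_right_mono) auto
  ultimately have "cmod (g x\<^sub>0) * cmod (f x\<^sub>0) \<le> cmod (g x\<^sub>0) * cmod (\<phi> f)" by simp
  moreover have "cmod (g x\<^sub>0) > 0" using \<open>g x\<^sub>0 * f x\<^sub>0 = 1\<close> by auto
  ultimately have "cmod (f x\<^sub>0) \<le> cmod (\<phi> f)" by simp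
  then show ?thesis using cmod_\<phi>_le[OF fg(1)] by simp
qed

text \<open>By \<open>cmod_\<phi>_le\<close> the kernel contains every function vanishing at
  \<open>x\<^sub>0\<close>. If it contains some \<open>f\<close> with
  \<open>f x\<^sub>0 \<noteq> 0\<close>, then \<open>g = f / f x\<^sub>0\<close> and
  \<open>1 - g\<close> are both in it, so two summands suffice.\<close>

lemma kernel_alternative:
  "maximalideal (fun_kernel A \<phi>) (function_ring A) \<or>
    (\<exists>(n::nat) fs. (\<forall>i\<in>{1..n}. fs i \<in> fun_kernel A \<phi>) \<and> 1 = (\<Sum>i=1..n. fs i))"
proof (cases "fun_kernel A \<phi> = {f \<in> A. f x\<^sub>0 = 0}")
  case True
  then show ?thesis using maximalideal_point by simp
next
  case False
  have vanish: "f \<in> fun_kernel A \<phi>" if "f \<in> A" "f x\<^sub>0 = 0" for f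
    using cmod_\<phi>_le[OF that(1)] that by (simp add: fun_kernel_def)
  then obtain f where f: "f \<in> A" "\<phi> f = 0" "f x\<^sub>0 \<noteq> 0"
    using False by (auto simp: fun_kernel_def)
  define g where "g = (\<lambda>y. 1 / f x\<^sub>0 * f y)"
  have g: "g \<in> A" unfolding g_def using f by (intro A_scale)
  have "g \<in> fun_kernel A \<phi>" using g \<phi>_scale[OF f(1), of "1 / f x\<^sub>0"] f(2) by (simp add: fun_kernel_def g_def)
  moreover have "1 - g \<in> fun_kernel A \<phi>"
    using g f(3) by (intro vanish A_diff A_1) (simp_all add: g_def fun_apply)
  moreover have "1 = (\<Sum>i=1..2::nat. if i = 1 then g else 1 - g)" by (simp add: numeral_2_eq_2)
  ultimately show ?thesis
    by (intro disjI2 exI[of _ 2] exI[of _ "\<lambda>i. if i = 1 then g else 1 - g"]) simp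
qed

text \<open>
  The logarithm turns a peaking function with values in the half-plane \<open>Re \<ge> 0\<close> into one with
  values in a thin strip around the positive real axis.
\<close>

lemma strip_peaking:
  assumes uniform: "uniform_algebra A N" and U: "open U" "x\<^sub>0 \<in> U" and d: "0 < d" "d \<le> 1" and "K \<ge> 0"
  obtains g where "g \<in> A" "\<And>y. y \<notin> U \<Longrightarrow> K \<le> Re (g y)" "\<And>y. 0 \<le> Re (g y)" "Re (g x\<^sub>0) \<le> 1"
    "\<And>y. \<bar>Im (g y)\<bar> \<le> 2 * d"
proof -
  obtain h' where h': "h' \<in> A" "\<And>y. 0 \<le> Re (h' y)" "\<And>y. y \<notin> U \<Longrightarrow> exp (K / d) \<le> Re (h' y)"
    "Re (h' x\<^sub>0) < 1"
    using Choquet_peaking[OF _ U, of 1 "exp (K / d)"] choquet by auto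
  \<comment> \<open>The shift makes \<open>h x\<^sub>0\<close> real, so its modulus is controlled by
    its real part, and gives \<open>Re h \<ge> 1\<close>, as \<open>Ln_in_A\<close>
    requires.\<close>
  define h where "h = (\<lambda>y. h' y - (\<i> * of_real (Im (h' x\<^sub>0)) - 1))"
  have h: "h \<in> A" unfolding h_def using h' by (intro A_diff_const)
  have Re_h: "Re (h y) = Re (h' y) + 1" for y by (simp add: h_def)
  have Re_h_ge: "Re (h y) \<ge> 1" for y using h'(2)[of y] by (simp add: Re_h)
  have nz: "h y \<noteq> 0" for y using Re_h_ge[of y] by auto
  \<comment> \<open>The factor \<open>d\<close> thins the strip; the level exp (K / d) of
    \<open>h'\<close> off \<open>U\<close> was chosen so that \<open>d * Ln\<close> returns
    \<open>K\<close>.\<close>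
  define g where "g = (\<lambda>y. of_real d * Ln (h y))"
  have Re_g: "Re (g y) = d * ln (cmod (h y))" for y using nz by (simp add: g_def)
  show ?thesis
  proof (rule that[of g])
    show "g \<in> A" unfolding g_def using uniform h Re_h_ge by (intro A_scale Ln_in_A)
    show "K \<le> Re (g y)" if "y \<notin> U" for y
    proof -
      have "exp (K / d) \<le> cmod (h y)" using h'(3)[OF that] Re_h[of y] complex_Re_le_cmod[of "h y"] by simp
      then have "K / d \<le> ln (cmod (h y))" using nz[of y] by (simp add: ln_ge_iff)
      then show ?thesis using d by (simp add: Re_g divide_le_eq mult.commute)
    qed
    show "0 \<le> Re (g y)" for y
      using d Re_h_ge[of y] complex_Re_le_cmod[of "h y"] by (simp add: Re_g)
    show "Re (g x\<^sub>0) \<le> 1"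
    proof -
      have "h x\<^sub>0 = of_real (Re (h' x\<^sub>0) + 1)" by (simp add: h_def complex_eq_iff)
      then have "cmod (h x\<^sub>0) = Re (h' x\<^sub>0) + 1" using h'(2)[of x\<^sub>0] by (metis Re_h Re_h_ge abs_of_nonneg norm_of_real order_trans zero_le_one)
      moreover have "ln (1 + Re (h' x\<^sub>0)) \<le> Re (h' x\<^sub>0)" by (rule ln_add_one_self_le_self[OF h'(2)])
      ultimately have "ln (cmod (h x\<^sub>0)) \<le> 1" using h'(4) by (simp add: add.commute)
      then have "d * ln (cmod (h x\<^sub>0)) \<le> d * 1" using d by (intro mult_left_mono) auto
      then show ?thesis using d unfolding Re_g by linarith
    qed
    show "\<bar>Im (g y)\<bar> \<le> 2 * d" for y
    proof -
      \<comment> \<open>The right half-plane gives the bound pi / 2, and pi < 4.\<close>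
      have "\<bar>Im (Ln (h y))\<bar> \<le> 2"
        using Re_Ln_pos_lt_imp[of "h y"] Re_h_ge[of y] pi_less_4 nz[of y] by (smt (verit) field_sum_of_halves)
      then have "d * \<bar>Im (Ln (h y))\<bar> \<le> d * 2" using d by (intro mult_left_mono) auto
      then show ?thesis using d by (simp add: g_def abs_mult)
    qed
  qed
qed

text \<open>After normalising to \<open>F x\<^sub>0 = 1\<close>, the number
  \<open>\<omega> = \<phi> F\<close> has modulus 1. The spectral condition for F exp (- g) gives
  \<open>\<omega> = F y * exp (g x\<^sub>0 - g y)\<close> for some \<open>y\<close>. The modulus
  forces \<open>y \<in> U\<close>, where \<open>F\<close> is near 1, and the thin strip keeps the
  argument of the exponential small.\<close>

lemma \<phi>_uniform_inv_group:
  assumes uniform: "uniform_algebra A N" and inv: "f \<in> inv_group A" shows "\<phi> f = f x\<^sub>0"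
proof -
  obtain f' where f': "f \<in> A" "f' \<in> A" "f' * f = 1" using inv by (rule inv_groupE)
  have "(f' * f) x\<^sub>0 = 1" by (simp add: f'(3) fun_apply)
  then have nz: "f x\<^sub>0 \<noteq> 0" by (auto simp: fun_apply)
  define F where "F = (\<lambda>y. 1 / f x\<^sub>0 * f y)"
  have F: "F \<in> A" unfolding F_def using f' by (intro A_scale)
  have F1: "F x\<^sub>0 = 1" using nz by (simp add: F_def)
  define \<omega> where "\<omega> = \<phi> F"
  have \<omega>_eq: "\<omega> = \<phi> f / f x\<^sub>0" unfolding \<omega>_def F_def \<phi>_scale[OF f'(1)] by simp
  have \<omega>: "cmod \<omega> = 1" using cmod_\<phi>_inv_group[OF inv] nz by (simp add: \<omega>_eq norm_divide)
  have close: "cmod (\<omega> - 1) \<le> 6 * d" if d: "0 < d" "d \<le> 1" for d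
  proof -
    define U where "U = {y. cmod (F y - 1) < d}"
    have U: "open U" "x\<^sub>0 \<in> U"
      unfolding U_def using A_cont[OF F, of UNIV] d F1
      by (auto intro!: open_Collect_less continuous_intros)
    \<comment> \<open>As \<open>Re (g x\<^sub>0) \<le> 1\<close>, a point off \<open>U\<close> would
      have exponent at most \<open>- sup_norm F\<close>, and t exp (- t) < 1 for every real
      t.\<close>
    define K where "K = sup_norm F + 1"
    have K: "K \<ge> 0" using sup_norm_nonneg[OF F] by (simp add: K_def)
    obtain g where g: "g \<in> A" "\<And>y. y \<notin> U \<Longrightarrow> K \<le> Re (g y)" "\<And>y. 0 \<le> Re (g y)"
      "Re (g x\<^sub>0) \<le> 1" "\<And>y. \<bar>Im (g y)\<bar> \<le> 2 * d"
      using strip_peaking[OF uniform U d K] by blast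
    let ?p = "\<lambda>y. exp ((- g) y)"
    have p: "?p \<in> A" using g by (intro exp_in_A A_uminus)
    obtain y where y: "\<phi> (F * ?p) = (F * ?p) y" using \<phi>_range[OF A_mult[OF F p]] by blast
    have "\<omega> * exp (- g x\<^sub>0) = F y * exp (- g y)"
      using \<phi>_mult[OF F p] exp_eval[OF A_uminus[OF g(1)]] y by (simp add: \<omega>_def fun_apply)
    then have \<omega>F: "\<omega> = F y * exp (g x\<^sub>0 - g y)"
      by (simp add: exp_diff exp_minus field_simps)
    then have norm: "1 = cmod (F y) * exp (Re (g x\<^sub>0 - g y))" using \<omega> by (metis norm_exp_eq_Re norm_mult)
    have "y \<in> U"
    proof (rule ccontr)
      assume "y \<notin> U"
      then have "exp (Re (g x\<^sub>0 - g y)) \<le> exp (- sup_norm F)" using g(2)[of y] g(4) by (simp add: K_def)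
      then have "1 \<le> sup_norm F * exp (- sup_norm F)"
        unfolding norm using cmod_le_sup_norm[OF F, of y] sup_norm_nonneg[OF F] by (intro mult_mono) auto
      moreover have "sup_norm F < exp (sup_norm F)" using exp_ge_add_one_self[of "sup_norm F"] by linarith
      ultimately show False by (simp add: exp_minus field_simps)
    qed
    then have Fy: "cmod (F y - 1) \<le> d" by (simp add: U_def)
    define u where "u = cis (Im (g x\<^sub>0 - g y))"
    define r where "r = exp (Re (g x\<^sub>0 - g y))"
    have "\<omega> = F y * (of_real r * u)" unfolding \<omega>F r_def u_def exp_eq_polar by simp
    \<comment> \<open>The modulus correction contributes at most 2 d and the argument
      \<open>u\<close> at most 4 d.\<close>
    then have \<omega>u: "\<omega> - 1 = (F y * of_real r - 1) * u + (u - 1)" by (simp add: algebra_simps)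
    have Fr: "cmod (F y) * r = 1" using norm by (simp add: r_def)
    have "F y * of_real r - 1 = (F y - 1) + F y * of_real (r - 1)" by (simp add: algebra_simps)
    then have "cmod (F y * of_real r - 1) \<le> cmod (F y - 1) + cmod (F y) * \<bar>r - 1\<bar>"
      by (metis norm_mult norm_of_real norm_triangle_ineq)
    also have "cmod (F y) * \<bar>r - 1\<bar> = \<bar>1 - cmod (F y)\<bar>"
    proof -
      have "cmod (F y) * \<bar>r - 1\<bar> = \<bar>cmod (F y) * (r - 1)\<bar>" by (simp add: abs_mult)
      also have "cmod (F y) * (r - 1) = 1 - cmod (F y)" using Fr by (simp add: right_diff_distrib)
      finally show ?thesis .
    qed
    also have "\<dots> \<le> cmod (F y - 1)"
      using norm_triangle_ineq3[of 1 "F y"] by (simp add: norm_minus_commute)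
    finally have part1: "cmod (F y * of_real r - 1) \<le> 2 * d" using Fy by simp
    have part2: "cmod (u - 1) \<le> 4 * d"
    proof -
      have "cmod (u - 1) \<le> \<bar>Im (g x\<^sub>0 - g y)\<bar>"
        using dist_exp_i_1[of "Im (g x\<^sub>0 - g y)"] abs_sin_x_le_abs_x[of "Im (g x\<^sub>0 - g y) / 2"]
        by (simp add: u_def cis_conv_exp)
      also have "\<dots> \<le> 4 * d" using g(5)[of x\<^sub>0] g(5)[of y] by simp
      finally show ?thesis .
    qed
    have "cmod (\<omega> - 1) \<le> cmod (F y * of_real r - 1) * cmod u + cmod (u - 1)"
      unfolding \<omega>u by (metis norm_mult norm_triangle_ineq)
    then show ?thesis using part1 part2 by (simp add: u_def)
  qed
  have "\<omega> = 1"
  proof (rule ccontr)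
    assume "\<omega> \<noteq> 1"
    then have pos: "cmod (\<omega> - 1) > 0" by simp
    have "cmod (\<omega> - 1) \<le> 2" using norm_triangle_ineq4[of \<omega> 1] \<omega> by simp
    \<comment> \<open>With \<open>d = cmod (\<omega> - 1) / 12\<close> the estimate bounds |omega -
      1| by half of itself; |omega - 1| <= 2 ensures \<open>d \<le> 1\<close>.\<close>
    then show False using close[of "cmod (\<omega> - 1) / 12"] pos by simp
  qed
  then show ?thesis using \<omega>_eq nz by simp
qed

end

theorem proposition3p1:
  fixes A :: "('a::t2_space \<Rightarrow> complex) set"
    and N :: "('a \<Rightarrow> complex) \<Rightarrow> real"
    and \<phi> :: "('a \<Rightarrow> complex) \<Rightarrow> complex"
  assumes "compact (UNIV :: 'a set)"
    and "banach_function_algebra A N"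
    and "natural_algebra A"
    and "choquet_boundary A = UNIV"
    and "multiplicative A \<phi>"
    and "spectral A \<phi>"
  shows
    "(\<exists>!x\<^sub>0. \<forall>f\<in>A. cmod (\<phi> f) \<le> cmod (f x\<^sub>0)) \<and>
     (\<forall>x\<^sub>0. (\<forall>f\<in>A. cmod (\<phi> f) \<le> cmod (f x\<^sub>0)) \<longrightarrow>
        (\<forall>f\<in>inv_group A. cmod (\<phi> f) = cmod (f x\<^sub>0))) \<and>
     (maximalideal (fun_kernel A \<phi>) (function_ring A) \<or>
        (\<exists>(n::nat) fs. (\<forall>i\<in>{1..n}. fs i \<in> fun_kernel A \<phi>) \<and> 1 = (\<Sum>i=1..n. fs i))) \<and>
     (uniform_algebra A N \<longrightarrow>
        (\<forall>x\<^sub>0. (\<forall>f\<in>A. cmod (\<phi> f) \<le> cmod (f x\<^sub>0)) \<longrightarrow>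
           (\<forall>f\<in>inv_group A. \<phi> f = f x\<^sub>0)))"
proof -
  interpret multiplicative_spectral A N \<phi> by unfold_locales (fact assms)+
  obtain z where z: "\<And>f. f \<in> A \<Longrightarrow> \<phi> (\<lambda>y. exp (f y)) = exp (f z)"
    using exp_evaluation by blast
  interpret choquet_spectral A N \<phi> z by unfold_locales (use assms z in auto)
  \<comment> \<open>The later claims quantify over every point satisfying the inequality; this
    identifies each such point with \<open>z\<close>.\<close>
  have unique: "x = z" if "\<forall>f\<in>A. cmod (\<phi> f) \<le> cmod (f x)" for x
    using that by (intro bound_point_unique) blast
  show ?thesis
  proof (intro conjI)
    show "\<exists>!x\<^sub>0. \<forall>f\<in>A. cmod (\<phi> f) \<le> cmod (f x\<^sub>0)"
      using cmod_\<phi>_le unique by (intro ex1I[of _ z]) blast+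
    show "\<forall>x\<^sub>0. (\<forall>f\<in>A. cmod (\<phi> f) \<le> cmod (f x\<^sub>0)) \<longrightarrow>
        (\<forall>f\<in>inv_group A. cmod (\<phi> f) = cmod (f x\<^sub>0))"
      using unique cmod_\<phi>_inv_group by blast
    show "uniform_algebra A N \<longrightarrow> (\<forall>x\<^sub>0. (\<forall>f\<in>A. cmod (\<phi> f) \<le> cmod (f x\<^sub>0)) \<longrightarrow>
        (\<forall>f\<in>inv_group A. \<phi> f = f x\<^sub>0))"
      using unique \<phi>_uniform_inv_group by blast
  qed (rule kernel_alternative)
qed

end
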